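(* Let $f(z)=z^2+c$ with $c\in\mathbb{C}$, and let $z_0\in\mathbb{C}$ be a fixed point of $f$. Then for every $\delta>0$ there exists $r_0>0$ such that for every integer $n>1$, setting $r_n=r_0\exp(-n\delta)$, there is at most one periodic orbit of $f$ of minimal period $n$ that is entirely contained in the open disc $B(z_0,r_n)$.
   Context: $B(z_0,r)$ denotes the open Euclidean disc of radius $r$ centred at $z_0$. *)

theory Defs
  imports "HOL-Analysis.Analysis"
begin

definition has_minimal_period :: "('a \<Rightarrow> 'a) \<Rightarrow> nat \<Rightarrow> 'a \<Rightarrow> bool" where
  "has_minimal_period f n p \<longleftrightarrow> n > 0 \<and> (f ^^ n) p = p \<and> (\<forall>k. 0 < k \<and> k < n \<longrightarrow> (f ^^ k) p \<noteq> p)"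

definition periodic_orbit :: "('a \<Rightarrow> 'a) \<Rightarrow> nat \<Rightarrow> 'a \<Rightarrow> 'a set" where
  "periodic_orbit f n p = {(f ^^ k) p | k. k < n}"

end

theory Submission
  imports Defs "HOL-Complex_Analysis.Complex_Analysis"
begin

text \<open>
  Put \<open>\<lambda> = f'(z0) = 2 * z0\<close>.  If \<open>|\<lambda>| \<noteq> 1\<close>, the distance to \<open>z0\<close> is strictly monotone along orbits near
  \<open>z0\<close>; if \<open>\<lambda> = 1\<close>, a small cycle would satisfy \<open>\<Sum>(x i - z0)\<^sup>2 = 0\<close> with nearly equal summands.

  Otherwise let \<open>p = x 0, x 1, \<dots>\<close> and \<open>q\<close> generate two small \<open>n\<close>-cycles, \<open>p\<close> being the point of both
  cycles farthest from \<open>z0\<close>, and let \<open>\<rho>\<close> be the multiplier of the cycle of \<open>p\<close>.  Since \<open>f\<^sup>n(z) - z\<close>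
  vanishes at \<open>z0\<close> and on both cycles, \<open>|\<rho> - 1|\<close> is at most
  \<open>K |p - z0| \<Prod>|p - x j| \<Prod>|p - q j|\<close> with \<open>K = (C n)\<^sup>2\<^sup>n\<close>.  In the other direction, the quadratic
  differential \<open>\<psi>(z) dz\<^sup>2\<close> that has simple poles along the cycle of \<open>p\<close> and a double pole at \<open>z0\<close>,
  normalised so that its pushforward under \<open>f\<close> has no pole at the critical value, is reproduced by the
  pushforward up to \<open>(1/\<rho> - 1) / (z - p)\<close>.  As the pushforward contracts the \<open>L\<^sup>1\<close> norm, \<open>\<psi>\<close> is
  small on the points that leave a large disc, and the mean value property of the polynomial
  \<open>(z - z0)\<^sup>2 \<Prod>(z - x j) \<psi>(z)\<close> gives \<open>|p - z0|\<^sup>2 \<Prod>|p - x j| \<le> C\<^sup>n |1/\<rho> - 1|\<close>.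
  Together \<open>1 \<le> C\<^sup>n K |p - z0|\<^sup>n\<^sup>-\<^sup>1\<close>, which fails once \<open>(C n)\<^sup>4 |p - z0| < 1\<close>.
\<close>

section \<open>Area integrals over the complex plane\<close>

text \<open>The area formula \<open>measure_differentiable_image\<close> lives on
  \<open>real^2\<close>, with the Jacobian as the determinant of a matrix; these two maps carry it
  over to \<open>complex\<close>.\<close>

definition vec_of_complex :: "complex \<Rightarrow> real^2" where
  "vec_of_complex z = vector [Re z, Im z]"

definition complex_of_vec :: "real^2 \<Rightarrow> complex" where
  "complex_of_vec v = Complex (v $ 1) (v $ 2)"

lemma complex_of_vec_of_complex [simp]: "complex_of_vec (vec_of_complex z) = z"
  and vec_of_complex_of_vec [simp]: "vec_of_complex (complex_of_vec v) = v"
  by (simp_all add: complex_of_vec_def vec_of_complex_def vec_eq_iff forall_2)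

lemma linear_vec_of_complex: "linear vec_of_complex"
  by (rule linearI) (simp_all add: vec_of_complex_def vec_eq_iff forall_2)

lemma linear_complex_of_vec: "linear complex_of_vec"
  by (rule linearI) (simp_all add: complex_of_vec_def complex_eq_iff)

lemma borel_measurable_complex_of_vec [measurable]: "complex_of_vec \<in> borel_measurable borel"
  by (intro borel_measurable_continuous_onI linear_continuous_on linear_conv_bounded_linear[THEN iffD1]
        linear_complex_of_vec)

lemma lborel_distr_complex_of_vec: "distr lborel borel complex_of_vec = lborel"
proof (rule lborel_eqI[symmetric])
  fix l u :: complex
  assume lu: "\<And>b. b \<in> Basis \<Longrightarrow> l \<bullet> b \<le> u \<bullet> b"
  have *: "Re l \<le> Re u" "Im l \<le> Im u"
    using lu[of 1] lu[of "\<i>"] by (simp_all add: Basis_complex_def)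
  have "emeasure (distr lborel borel complex_of_vec) (box l u)
      = emeasure lborel (complex_of_vec -` box l u)"
    by (subst emeasure_distr) auto
  also have "complex_of_vec -` box l u = box (vec_of_complex l) (vec_of_complex u)"
    by (auto simp: box_def complex_of_vec_def vec_of_complex_def Basis_complex_def Basis_vec_def
          inner_axis forall_2)
  also have "emeasure lborel \<dots> = (\<Prod>b\<in>Basis. (u - l) \<bullet> b)"
    using * by (subst emeasure_lborel_box)
      (auto simp: Basis_vec_def inner_axis vec_of_complex_def Basis_complex_def prod.union_disjoint
         UNIV_2 axis_eq_axis vector_2)
  finally show "emeasure (distr lborel borel complex_of_vec) (box l u) = (\<Prod>b\<in>Basis. (u - l) \<bullet> b)" .
qed simp

lemma emeasure_vimage_complex_of_vec:
  assumes "A \<in> sets borel"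
  shows "emeasure lborel (complex_of_vec -` A) = emeasure lborel A"
  using emeasure_distr[of complex_of_vec lborel borel A] assms by (simp add: lborel_distr_complex_of_vec)

lemma nn_integral_complex_of_vec:
  assumes "f \<in> borel_measurable borel"
  shows "(\<integral>\<^sup>+v. f (complex_of_vec v) \<partial>lborel) = (\<integral>\<^sup>+z. f z \<partial>lborel)"
  using nn_integral_distr[of complex_of_vec lborel borel f] assms by (simp add: lborel_distr_complex_of_vec)

text \<open>The real matrix of multiplication by \<open>c\<close> has rows
  \<open>(Re c, - Im c)\<close> and \<open>(Im c, Re c)\<close>. With \<open>c = f' z\<close> this
  is the Jacobian determinant of a holomorphic map.\<close>

lemma det_matrix_complex_mult:
  "det (matrix (\<lambda>v. vec_of_complex (c * complex_of_vec v))) = (cmod c)\<^sup>2"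
  unfolding cmod_power2
  by (simp add: det_2 matrix_def vec_of_complex_def complex_of_vec_def axis_def power2_eq_square)

text \<open>The area formula without injectivity: points covered several times only enlarge the
  right-hand side. A Borel set \<open>B\<close> inside the image is used because the image itself is
  only known to be Lebesgue measurable.\<close>

lemma emeasure_le_nn_integral_deriv:
  fixes f f' :: "complex \<Rightarrow> complex"
  assumes S: "S \<in> sets borel" and B: "B \<in> sets borel" and BS: "B \<subseteq> f ` S"
    and f: "\<And>z. z \<in> S \<Longrightarrow> (f has_field_derivative f' z) (at z)"
    and f': "f' \<in> borel_measurable borel"
  shows "emeasure lborel B \<le> (\<integral>\<^sup>+z. ennreal ((cmod (f' z))\<^sup>2) * indicator S z \<partial>lborel)" (is "_ \<le> ?I")
\<comment> \<open>An infinite right-hand side is trivial; a finite one makes the Jacobian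
  integrable, as the area formula requires.\<close>
proof (cases "?I = \<infinity>")
  case False
  define S' where "S' = complex_of_vec -` S"
  define g where "g = (\<lambda>v. vec_of_complex (f (complex_of_vec v)))"
  define g' where "g' = (\<lambda>x v. vec_of_complex (f' (complex_of_vec x) * complex_of_vec v))"
  define h where "h = (\<lambda>x. (cmod (f' (complex_of_vec x)))\<^sup>2)"
  have S': "S' \<in> sets borel"
    using measurable_sets[OF borel_measurable_complex_of_vec S] by (simp add: S'_def)
  have h [measurable]: "h \<in> borel_measurable borel"
    unfolding h_def using f' by measurable
  have det: "\<bar>det (matrix (g' x))\<bar> = h x" for x
    unfolding g'_def h_def by (simp add: det_matrix_complex_mult)
  have der: "(g has_derivative g' x) (at x within S')" if "x \<in> S'" for x
  proof -
    have "(f has_derivative (\<lambda>h. f' (complex_of_vec x) * h)) (at (complex_of_vec x))"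
      using f[of "complex_of_vec x"] that unfolding S'_def has_field_derivative_def by simp
    moreover have "(complex_of_vec has_derivative complex_of_vec) (at x within S')"
      using linear_complex_of_vec linear_imp_has_derivative by blast
    ultimately have "((\<lambda>v. f (complex_of_vec v)) has_derivative
        (\<lambda>v. f' (complex_of_vec x) * complex_of_vec v)) (at x within S')"
      using has_derivative_compose by blast
    then show ?thesis
      unfolding g_def g'_def
      using has_derivative_compose[OF _ linear_imp_has_derivative[OF linear_vec_of_complex]] by blast
  qed
  have I: "?I = (\<integral>\<^sup>+x. ennreal (h x) * indicator S' x \<partial>lborel)"
    by (subst nn_integral_complex_of_vec[symmetric])
      (use S f' in \<open>auto simp: h_def S'_def indicator_def intro!: nn_integral_cong\<close>)
  have hi: "(\<integral>\<^sup>+x. ennreal (h x * indicator S' x) \<partial>lborel) = ?I"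
    unfolding I by (intro nn_integral_cong) (auto simp: indicator_def)
  have fin: "(\<integral>\<^sup>+x. ennreal (h x * indicator S' x) \<partial>lborel) = ennreal (enn2real ?I)"
    using False hi by (simp add: top.not_eq_extremum)
  have "((\<lambda>x. h x * indicator S' x) has_integral enn2real ?I) UNIV"
    by (rule nn_integral_has_integral[OF _ _ fin]) (use S' h in \<open>auto simp: h_def\<close>)
  moreover have "(\<lambda>x. h x * indicator S' x) = (\<lambda>x. if x \<in> S' then h x else 0)"
    by auto
  ultimately have hhas: "(h has_integral enn2real ?I) S'"
    by (simp only: has_integral_restrict_UNIV)
  have "(\<lambda>x. \<bar>det (matrix (g' x))\<bar>) integrable_on S'"
    using hhas unfolding det by blast
  moreover have "S' \<in> sets lebesgue" using S' by simp
  ultimately have gS: "g ` S' \<in> lmeasurable"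
    and gm: "measure lebesgue (g ` S') \<le> integral S' (\<lambda>x. \<bar>det (matrix (g' x))\<bar>)"
    using measurable_differentiable_image[OF _ der] measure_differentiable_image[OF _ der] by auto
  have "complex_of_vec -` B \<subseteq> g ` S'"
  proof
    fix v assume "v \<in> complex_of_vec -` B"
    then obtain z where z: "z \<in> S" "complex_of_vec v = f z" using BS by blast
    have "v = g (vec_of_complex z)"
      unfolding g_def using z by (metis complex_of_vec_of_complex vec_of_complex_of_vec)
    then show "v \<in> g ` S'" using z by (auto simp: S'_def)
  qed
  moreover have "complex_of_vec -` B \<in> sets borel"
    using measurable_sets[OF borel_measurable_complex_of_vec B] by simp
  moreover have "emeasure lebesgue (complex_of_vec -` B) = emeasure lborel B"
    using calculation(2) emeasure_vimage_complex_of_vec[OF B] by simp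
  ultimately have "emeasure lborel B \<le> emeasure lebesgue (g ` S')"
    using gS by (metis emeasure_mono fmeasurableD)
  also have "\<dots> = ennreal (measure lebesgue (g ` S'))"
    using gS by (simp add: emeasure_eq_measure2)
  also have "\<dots> \<le> ennreal (enn2real ?I)"
    using gm hhas unfolding det by (intro ennreal_leI) (simp add: integral_unique)
  also have "\<dots> = ?I"
    using False by (simp add: top.not_eq_extremum)
  finally show ?thesis .
qed simp

text \<open>Passes from sets to functions: the preceding bound, applied to every Borel set, compares
  area on \<open>T\<close> with the image under \<open>f\<close> of Jacobian-weighted area on
  \<open>S\<close>, and integrals are monotone in the measure.\<close>

lemma nn_integral_image_le:
  fixes f f' :: "complex \<Rightarrow> complex" and F :: "complex \<Rightarrow> ennreal"
  assumes S [measurable]: "S \<in> sets borel" and T [measurable]: "T \<in> sets borel" and TS: "T \<subseteq> f ` S"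
    and f: "\<And>z. z \<in> S \<Longrightarrow> (f has_field_derivative f' z) (at z)"
    and f' [measurable]: "f' \<in> borel_measurable borel" and fm [measurable]: "f \<in> borel_measurable borel"
    and F [measurable]: "F \<in> borel_measurable borel"
  shows "(\<integral>\<^sup>+z. F z * indicator T z \<partial>lborel)
       \<le> (\<integral>\<^sup>+z. F (f z) * ennreal ((cmod (f' z))\<^sup>2) * indicator S z \<partial>lborel)"
proof -
  let ?M = "density lborel (indicator T)"
  let ?N = "distr (density lborel (\<lambda>z. ennreal ((cmod (f' z))\<^sup>2) * indicator S z)) borel f"
  have "emeasure ?M B \<le> emeasure ?N B" if B [measurable]: "B \<in> sets borel" for B
  proof -
    have [measurable]: "f -` B \<in> sets borel"
      using measurable_sets[OF fm B] by simp
    have "emeasure ?M B = emeasure lborel (B \<inter> T)"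
      by (subst emeasure_density) (auto simp: indicator_inter_arith[symmetric] Int_commute)
    also have "\<dots> \<le> (\<integral>\<^sup>+z. ennreal ((cmod (f' z))\<^sup>2) * indicator (S \<inter> f -` B) z \<partial>lborel)"
      using TS by (intro emeasure_le_nn_integral_deriv[where f = f]) (use S f' f in auto)
    also have "\<dots> = emeasure ?N B"
      by (subst emeasure_distr, simp, simp, subst emeasure_density)
        (auto simp: indicator_inter_arith mult.assoc intro!: nn_integral_cong)
    finally show ?thesis .
  qed
  then have "nn_integral ?M F \<le> nn_integral ?N F"
    by (intro nn_integral_mono_measure) (auto simp: le_measure)
  then show ?thesis
    by (simp add: nn_integral_density nn_integral_distr mult_ac)
qed

text \<open>Rotations about \<open>a\<close> are onto with Jacobian 1, so the image bound gives one
  inequality; applied to the inverse rotation it gives the other.\<close>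

lemma nn_integral_rotate:
  fixes F :: "complex \<Rightarrow> ennreal"
  assumes [measurable]: "F \<in> borel_measurable borel" and \<omega>: "cmod \<omega> = 1"
  shows "(\<integral>\<^sup>+z. F (a + \<omega> * (z - a)) \<partial>lborel) = (\<integral>\<^sup>+z. F z \<partial>lborel)"
proof (rule antisym)
  have le: "(\<integral>\<^sup>+z. G z \<partial>lborel) \<le> (\<integral>\<^sup>+z. G (a + w * (z - a)) \<partial>lborel)"
    if G: "G \<in> borel_measurable borel" and w: "cmod w = 1" for G :: "complex \<Rightarrow> ennreal" and w
  proof -
    have "UNIV \<subseteq> range (\<lambda>z. a + w * (z - a))"
    proof
      fix x
      have "w \<noteq> 0" using w by auto
      then have "x = a + w * ((a + (x - a) / w) - a)" by simp
      then show "x \<in> range (\<lambda>z. a + w * (z - a))" by blast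
    qed
    then have "(\<integral>\<^sup>+z. G z * indicator UNIV z \<partial>lborel)
        \<le> (\<integral>\<^sup>+z. G (a + w * (z - a)) * ennreal ((cmod w)\<^sup>2) * indicator UNIV z \<partial>lborel)"
      using G by (intro nn_integral_image_le[where f = "\<lambda>z. a + w * (z - a)"])
        (auto intro!: derivative_eq_intros)
    then show ?thesis using w by simp
  qed
  show "(\<integral>\<^sup>+z. F z \<partial>lborel) \<le> (\<integral>\<^sup>+z. F (a + \<omega> * (z - a)) \<partial>lborel)"
    by (rule le) (use \<omega> in auto)
  have "(\<integral>\<^sup>+z. F (a + \<omega> * (z - a)) \<partial>lborel)
      \<le> (\<integral>\<^sup>+z. F (a + \<omega> * ((a + inverse \<omega> * (z - a)) - a)) \<partial>lborel)"
    by (rule le[where G = "\<lambda>z. F (a + \<omega> * (z - a))"]) (use \<omega> in \<open>auto simp: norm_inverse\<close>)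
  also have "\<dots> = (\<integral>\<^sup>+z. F z \<partial>lborel)"
  proof -
    have "\<omega> \<noteq> 0" using \<omega> by auto
    then have "\<omega> * (inverse \<omega> * x) = x" for x
      by (metis mult.assoc mult_1 right_inverse)
    then have "a + \<omega> * ((a + inverse \<omega> * (z - a)) - a) = z" for z
      by (simp only: add_diff_cancel_left' add_diff_eq)
    then show ?thesis by (simp only:)
  qed
  finally show "(\<integral>\<^sup>+z. F (a + \<omega> * (z - a)) \<partial>lborel) \<le> (\<integral>\<^sup>+z. F z \<partial>lborel)" .
qed

text \<open>Almost every point has one preimage under \<open>z\<^sup>2 + c\<close> in each of the
  half-planes \<open>P\<close> and \<open>N\<close>, so integrating over both counts
  \<open>F\<close> twice.\<close>

lemma nn_integral_square_ge:
  fixes F :: "complex \<Rightarrow> ennreal"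
  assumes [measurable]: "F \<in> borel_measurable borel"
  shows "2 * (\<integral>\<^sup>+z. F z \<partial>lborel) \<le> (\<integral>\<^sup>+z. F (z\<^sup>2 + c) * ennreal ((cmod (2 * z))\<^sup>2) \<partial>lborel)"
proof -
  \<comment> \<open>Points whose preimages lie on the imaginary axis have imaginary part
    \<open>Im c\<close>; discarding that whole line costs only a null set.\<close>
  define T where "T = {z. Im z \<noteq> Im c}"
  define P where "P = {z. 0 < Re z}"
  define N where "N = {z. Re z < 0}"
  let ?G = "\<lambda>z. F (z\<^sup>2 + c) * ennreal ((cmod (2 * z))\<^sup>2)"
  have [measurable]: "T \<in> sets borel" "P \<in> sets borel" "N \<in> sets borel"
    unfolding T_def P_def N_def by measurable
  have root: "\<exists>w. 0 < Re w \<and> w\<^sup>2 + c = z" if "z \<in> T" for z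
  proof (intro exI conjI)
    show "0 < Re (csqrt (z - c))"
    proof -
      have "Re (csqrt (z - c)) \<noteq> 0"
      proof
        assume "Re (csqrt (z - c)) = 0"
        then have "Im ((csqrt (z - c))\<^sup>2) = 0"
          unfolding power2_eq_square by simp
        then show False using that by (simp add: T_def)
      qed
      then show ?thesis using Re_csqrt[of "z - c"] by linarith
    qed
    show "(csqrt (z - c))\<^sup>2 + c = z" by simp
  qed
  have "T \<subseteq> (\<lambda>z. z\<^sup>2 + c) ` P"
    using root unfolding P_def by force
  moreover have "T \<subseteq> (\<lambda>z. z\<^sup>2 + c) ` N"
  proof
    fix z assume "z \<in> T"
    then obtain w where "0 < Re w" "w\<^sup>2 + c = z" using root by blast
    then show "z \<in> (\<lambda>z. z\<^sup>2 + c) ` N" unfolding N_def by (intro image_eqI[of _ _ "- w"]) auto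
  qed
  ultimately have PN: "(\<integral>\<^sup>+z. F z * indicator T z \<partial>lborel) \<le> (\<integral>\<^sup>+z. ?G z * indicator P z \<partial>lborel)"
     "(\<integral>\<^sup>+z. F z * indicator T z \<partial>lborel) \<le> (\<integral>\<^sup>+z. ?G z * indicator N z \<partial>lborel)"
    by (intro nn_integral_image_le[where f = "\<lambda>z. z\<^sup>2 + c" and f' = "\<lambda>z. 2 * z"];
        auto intro!: derivative_eq_intros)+
  have "negligible {z::complex. z \<bullet> \<i> = Im c}"
    using negligible_standard_hyperplane[of "\<i>" "Im c"] by (auto simp: Basis_complex_def inner_commute)
  then have "{z. Im z = Im c} \<in> null_sets lborel"
    by (auto simp: negligible_iff_null_sets null_sets_completion_iff)
  then have "AE z in lborel. z \<in> T"
    by (rule AE_I') (auto simp: T_def)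
  then have T: "(\<integral>\<^sup>+z. F z * indicator T z \<partial>lborel) = (\<integral>\<^sup>+z. F z \<partial>lborel)"
    by (intro nn_integral_cong_AE) auto
  have G: "(\<lambda>z. ?G z * indicator P z) \<in> borel_measurable lborel"
    "(\<lambda>z. ?G z * indicator N z) \<in> borel_measurable lborel"
    by measurable
  have "2 * (\<integral>\<^sup>+z. F z \<partial>lborel)
      \<le> (\<integral>\<^sup>+z. ?G z * indicator P z \<partial>lborel) + (\<integral>\<^sup>+z. ?G z * indicator N z \<partial>lborel)"
    using add_mono[OF PN] by (simp only: T mult_2[of "\<integral>\<^sup>+z. F z \<partial>lborel"])
  also have "\<dots> = (\<integral>\<^sup>+z. ?G z * indicator P z + ?G z * indicator N z \<partial>lborel)"
    by (rule nn_integral_add[OF G, symmetric])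
  also have "\<dots> \<le> (\<integral>\<^sup>+z. ?G z \<partial>lborel)"
    by (intro nn_integral_mono) (simp add: P_def N_def split: split_indicator)
  finally show ?thesis .
qed

text \<open>Dyadic decomposition: where \<open>|z - a|\<close> lies between
  \<open>R / 2 ^ Suc k\<close> and \<open>R / 2 ^ k\<close>, the integrand is at most
  \<open>2 ^ Suc k / R\<close>, and the areas shrink like \<open>4 ^ (- k)\<close>, which leaves a
  geometric series.\<close>

lemma nn_integral_inverse_norm_le:
  fixes a :: complex
  assumes R: "R > 0"
  shows "(\<integral>\<^sup>+z. ennreal (1 / cmod (z - a)) * indicator (ball a R) z \<partial>lborel) \<le> ennreal (4 * pi * R)"
proof -
  let ?g = "\<lambda>k z. ennreal (2 ^ Suc k / R) * indicator (ball a (R / 2 ^ k)) z"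
  have pw: "ennreal (1 / cmod (z - a)) * indicator (ball a R) z \<le> (\<Sum>k. ?g k z)" for z
  proof (cases "z \<in> ball a R \<and> z \<noteq> a")
    case True
    define t where "t = cmod (z - a) / R"
    have t: "0 < t" "t < 1" using True R by (auto simp: t_def dist_norm norm_minus_commute)
    have "\<exists>k. t < (1/2) ^ k \<and> (1/2) ^ Suc k \<le> t"
    proof -
      obtain m where m: "(1/2) ^ m < t" using real_arch_pow_inv[of t "1/2"] t by auto
      define l where "l = (LEAST m. (1/2) ^ m \<le> t)"
      have l: "(1/2) ^ l \<le> t" unfolding l_def by (rule LeastI[of _ m]) (use m in simp)
      then have "l \<noteq> 0" using t by (intro notI) auto
      then obtain k where k: "l = Suc k" using not0_implies_Suc by blast
      have "\<not> (1/2) ^ k \<le> t" using not_less_Least[of k "\<lambda>m. (1/2) ^ m \<le> t"] k l_def by auto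
      then show ?thesis using l k by (intro exI[of _ k]) auto
    qed
    then obtain k where k: "t < (1/2) ^ k" "(1/2) ^ Suc k \<le> t" by blast
    have "cmod (z - a) < R / 2 ^ k" "R / 2 ^ Suc k \<le> cmod (z - a)"
      using k R by (simp_all add: t_def field_simps power_one_over)
    moreover have "1 / cmod (z - a) \<le> 2 ^ Suc k / R"
      using calculation True R by (simp add: field_simps)
    ultimately have "ennreal (1 / cmod (z - a)) * indicator (ball a R) z \<le> ?g k z"
      using True by (auto simp: dist_norm norm_minus_commute intro!: ennreal_leI)
    also have "\<dots> \<le> (\<Sum>k. ?g k z)"
    proof -
      have "f k \<le> suminf f" for f :: "nat \<Rightarrow> ennreal"
        using sum_le_suminf[of f "{k}"] by simp
      then show ?thesis .
    qed
    finally show ?thesis .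
  qed auto
  have "(\<integral>\<^sup>+z. ennreal (1 / cmod (z - a)) * indicator (ball a R) z \<partial>lborel) \<le> (\<integral>\<^sup>+z. (\<Sum>k. ?g k z) \<partial>lborel)"
    by (intro nn_integral_mono pw)
  also have "\<dots> = (\<Sum>k. \<integral>\<^sup>+z. ?g k z \<partial>lborel)"
    by (intro nn_integral_suminf borel_measurable_times_ennreal borel_measurable_indicator) auto
  also have "\<dots> = (\<Sum>k. ennreal (2 * pi * R * (1/2) ^ k))"
  proof (intro suminf_cong)
    fix k :: nat
    have "(\<integral>\<^sup>+z. ?g k z \<partial>lborel) = ennreal (2 ^ Suc k / R) * emeasure lborel (ball a (R / 2 ^ k))"
      by (intro nn_integral_cmult_indicator) auto
    also have "\<dots> = ennreal (2 ^ Suc k / R * (pi * (R / 2 ^ k)\<^sup>2))"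
      using R by (subst emeasure_ball) (simp_all add: ennreal_mult[symmetric] unit_ball_vol_2 del: times_divide_eq_left)
    also have "2 ^ Suc k / R * (pi * (R / 2 ^ k)\<^sup>2) = 2 * pi * R * (1/2) ^ k"
      using R by (simp add: field_simps power2_eq_square)
    finally show "(\<integral>\<^sup>+z. ?g k z \<partial>lborel) = ennreal (2 * pi * R * (1/2) ^ k)" .
  qed
  also have "\<dots> = ennreal (\<Sum>k. 2 * pi * R * (1/2) ^ k)"
    using R by (intro suminf_ennreal2) (auto intro!: summable_mult)
  also have "(\<Sum>k. 2 * pi * R * (1/2) ^ k) = 4 * pi * R"
    by (subst suminf_mult) (auto simp: suminf_geometric)
  finally show ?thesis .
qed

section \<open>Pushforward of quadratic differentials\<close>

text \<open>By \<open>eq\<close>, \<open>\<psi> + h\<close> is the pushforward of the quadratic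
  differential \<open>\<psi>\<close>: its value at a point is the sum of \<open>\<psi>\<close>
  divided by the squared derivative \<open>4 * z\<^sup>2\<close> over the two preimages. The
  triangle inequality shows that the mass does not grow.\<close>

lemma nn_integral_pushforward_le:
  fixes \<psi> h :: "complex \<Rightarrow> complex"
  assumes [measurable]: "\<psi> \<in> borel_measurable borel" "h \<in> borel_measurable borel" "\<Omega> \<in> sets borel"
    and eq: "AE z in lborel. \<psi> z + \<psi> (- z) = 4 * z\<^sup>2 * (\<psi> (z\<^sup>2 + c) + h (z\<^sup>2 + c))"
  shows "(\<integral>\<^sup>+z. ennreal (cmod (\<psi> z + h z)) * indicator \<Omega> z \<partial>lborel)
       \<le> (\<integral>\<^sup>+z. ennreal (cmod (\<psi> z)) * indicator \<Omega> (z\<^sup>2 + c) \<partial>lborel)"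
proof -
  let ?F = "\<lambda>z. ennreal (cmod (\<psi> z + h z)) * indicator \<Omega> z"
  let ?G = "\<lambda>z. ennreal (cmod (\<psi> z)) * indicator \<Omega> (z\<^sup>2 + c)"
  have F: "?F \<in> borel_measurable borel" and G: "?G \<in> borel_measurable borel"
    by measurable
  \<comment> \<open>The reflection \<open>- z\<close> is spelled as a rotation about 0 so that
    \<open>nn_integral_rotate\<close> applies literally.\<close>
  have G': "(\<lambda>z. ?G (0 + (-1) * (z - 0))) \<in> borel_measurable lborel" "?G \<in> borel_measurable lborel"
    by measurable
  have "2 * (\<integral>\<^sup>+z. ?F z \<partial>lborel) \<le> (\<integral>\<^sup>+z. ?F (z\<^sup>2 + c) * ennreal ((cmod (2 * z))\<^sup>2) \<partial>lborel)"
    by (rule nn_integral_square_ge[OF F])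
  also have "\<dots> \<le> (\<integral>\<^sup>+z. ?G z + ?G (0 + (-1) * (z - 0)) \<partial>lborel)"
  proof (rule nn_integral_mono_AE)
    show "AE z in lborel. ?F (z\<^sup>2 + c) * ennreal ((cmod (2 * z))\<^sup>2) \<le> ?G z + ?G (0 + (-1) * (z - 0))"
      using eq
    proof eventually_elim
      case (elim z)
      have "cmod (\<psi> (z\<^sup>2 + c) + h (z\<^sup>2 + c)) * (cmod (2 * z))\<^sup>2 = cmod (\<psi> z + \<psi> (- z))"
        unfolding elim by (simp add: norm_mult norm_power power2_eq_square)
      also have "\<dots> \<le> cmod (\<psi> z) + cmod (\<psi> (- z))"
        by (rule norm_triangle_ineq)
      finally have "ennreal (cmod (\<psi> (z\<^sup>2 + c) + h (z\<^sup>2 + c))) * ennreal ((cmod (2 * z))\<^sup>2)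
          \<le> ennreal (cmod (\<psi> z)) + ennreal (cmod (\<psi> (- z)))"
        by (simp add: ennreal_mult[symmetric] ennreal_plus[symmetric] ennreal_leI del: ennreal_plus)
      then show ?case
        by (simp split: split_indicator)
    qed
  qed
  also have "\<dots> = (\<integral>\<^sup>+z. ?G z \<partial>lborel) + (\<integral>\<^sup>+z. ?G (0 + (-1) * (z - 0)) \<partial>lborel)"
    by (rule nn_integral_add[OF G'(2,1)])
  also have "(\<integral>\<^sup>+z. ?G (0 + (-1) * (z - 0)) \<partial>lborel) = (\<integral>\<^sup>+z. ?G z \<partial>lborel)"
    by (rule nn_integral_rotate[OF G]) simp
  finally have "2 * (\<integral>\<^sup>+z. ?F z \<partial>lborel) \<le> 2 * (\<integral>\<^sup>+z. ?G z \<partial>lborel)"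
    by (simp only: mult_2[of "\<integral>\<^sup>+z. ?G z \<partial>lborel"])
  then show ?thesis
    by (subst (asm) ennreal_mult_le_mult_iff) auto
qed

text \<open>
  The double pole at \<open>z0\<close> is not integrable, so a disc of radius \<open>\<eta>\<close> is removed.  Because
  \<open>|f'(z0)| = 1\<close>, the part of the removed disc that \<open>f\<close> maps outside it is an annulus of relative
  width \<open>O(\<eta>)\<close>, whose contribution vanishes as \<open>\<eta> \<rightarrow> 0\<close>.
\<close>

lemma nn_integral_escaping_le:
  fixes \<psi> h :: "complex \<Rightarrow> complex"
  assumes \<psi> [measurable]: "\<psi> \<in> borel_measurable borel" and h [measurable]: "h \<in> borel_measurable borel"
    and A [measurable]: "A \<in> sets borel"
    and A_sub: "A \<subseteq> ball 0 9" and A_disj: "A \<inter> ball 0 4 = {}"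
    and fixed: "z0\<^sup>2 + c = z0" and neutral: "cmod (2 * z0) = 1"
    and eq: "AE z in lborel. \<psi> z + \<psi> (- z) = 4 * z\<^sup>2 * (\<psi> (z\<^sup>2 + c) + h (z\<^sup>2 + c))"
    and fin: "\<And>\<eta>. \<eta> > 0 \<Longrightarrow>
      (\<integral>\<^sup>+z. ennreal (cmod (\<psi> z)) * indicator (ball 0 9 - cball z0 \<eta>) z \<partial>lborel) < \<infinity>"
    and \<eta>0: "\<eta>0 > 0"
    and pole: "\<And>z. 0 < cmod (z - z0) \<Longrightarrow> cmod (z - z0) \<le> \<eta>0 \<Longrightarrow> cmod (\<psi> z) \<le> M / (cmod (z - z0))\<^sup>2"
  shows "(\<integral>\<^sup>+z. ennreal (cmod (\<psi> z)) * indicator A z \<partial>lborel)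
       \<le> (\<integral>\<^sup>+z. ennreal (cmod (h z)) * indicator (ball 0 9) z \<partial>lborel)"
proof (rule ennreal_le_epsilon)
  fix e :: real assume e: "e > 0"
  define I where "I = (\<lambda>S. \<integral>\<^sup>+z. ennreal (cmod (\<psi> z)) * indicator S z \<partial>lborel)"
  let ?H = "\<integral>\<^sup>+z. ennreal (cmod (h z)) * indicator (ball 0 9) z \<partial>lborel"
  have M: "M \<ge> 0"
  proof -
    have "0 \<le> cmod (\<psi> (z0 + of_real \<eta>0))" by simp
    also have "\<dots> \<le> M / (cmod (z0 + of_real \<eta>0 - z0))\<^sup>2"
      using \<eta>0 by (intro pole) auto
    finally show ?thesis using \<eta>0 by (simp add: zero_le_divide_iff)
  qed
  have I_mono: "I S \<le> I T" if "S \<subseteq> T" for S T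
    unfolding I_def using that by (intro nn_integral_mono) (auto split: split_indicator)
  have I_Un: "I (S \<union> T) \<le> I S + I T" if [measurable]: "S \<in> sets borel" "T \<in> sets borel" for S T
  proof -
    have "I (S \<union> T) \<le> (\<integral>\<^sup>+z. ennreal (cmod (\<psi> z)) * indicator S z + ennreal (cmod (\<psi> z)) * indicator T z \<partial>lborel)"
      unfolding I_def by (intro nn_integral_mono) (auto split: split_indicator)
    also have "\<dots> = I S + I T"
      unfolding I_def by (rule nn_integral_add) measurable
    finally show ?thesis .
  qed
  have I_Un_disj: "I S + I T = I (S \<union> T)" if [measurable]: "S \<in> sets borel" "T \<in> sets borel" and "S \<inter> T = {}" for S T
  proof -
    have "I S + I T = (\<integral>\<^sup>+z. ennreal (cmod (\<psi> z)) * indicator S z + ennreal (cmod (\<psi> z)) * indicator T z \<partial>lborel)"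
      unfolding I_def by (rule nn_integral_add[symmetric]) measurable
    also have "\<dots> = I (S \<union> T)"
      unfolding I_def using that(3) by (intro nn_integral_cong) (auto split: split_indicator)
    finally show ?thesis .
  qed
  \<comment> \<open>The last term makes the annulus \<open>thin\<close> below cost at most the slack
    \<open>e\<close>.\<close>
  define \<eta> where "\<eta> = min (min \<eta>0 1) (e / (8 * pi * (M + 1)))"
  have \<eta>: "0 < \<eta>" "\<eta> \<le> \<eta>0" "\<eta> \<le> 1" "8 * pi * M * \<eta> \<le> e"
  proof -
    show "0 < \<eta>" using \<eta>0 e M unfolding \<eta>_def by simp
    show "\<eta> \<le> \<eta>0" "\<eta> \<le> 1" unfolding \<eta>_def by auto
    have "\<eta> \<le> e / (8 * pi * (M + 1))" unfolding \<eta>_def by auto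
    moreover have "0 < 8 * pi * (M + 1)" using M by (intro mult_pos_pos) auto
    ultimately have "8 * pi * (M + 1) * \<eta> \<le> e"
      by (metis pos_le_divide_eq mult.commute)
    moreover have "8 * pi * M * \<eta> \<le> 8 * pi * (M + 1) * \<eta>"
      using \<open>0 < \<eta>\<close> M by (intro mult_right_mono mult_left_mono) auto
    ultimately show "8 * pi * M * \<eta> \<le> e" by linarith
  qed
  define \<Omega> where "\<Omega> = ball 0 9 - cball z0 \<eta>"
  define thin where "thin = cball z0 \<eta> - cball z0 (\<eta> / (1 + \<eta>))"
  have [measurable]: "\<Omega> \<in> sets borel" "thin \<in> sets borel" "ball (0::complex) 9 \<in> sets borel"
    unfolding \<Omega>_def thin_def by auto
  have z0: "cmod z0 = 1 / 2" using neutral by (simp add: norm_mult)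
  have c: "cmod c \<le> 1"
  proof -
    have "c = z0 - z0\<^sup>2" using fixed by (simp add: algebra_simps)
    then have "cmod c \<le> cmod z0 + cmod (z0\<^sup>2)" using norm_triangle_ineq4 by metis
    then show ?thesis by (simp add: z0 norm_power power_divide)
  qed
  \<comment> \<open>A point sent into \<open>ball 0 9\<close> has \<open>|z|^2 < 10\<close>, so it
    lies in \<open>ball 0 4\<close> and hence off \<open>A\<close>. Inside the removed disc the
    distance to \<open>z0\<close> grows at most by the factor \<open>1 + \<eta>\<close>, so only the
    outer rim can leave the disc.\<close>
  have preimage: "{z. z\<^sup>2 + c \<in> \<Omega>} \<subseteq> (\<Omega> - A) \<union> thin"
  proof
    fix z assume z: "z \<in> {z. z\<^sup>2 + c \<in> \<Omega>}"
    have "cmod (z\<^sup>2) \<le> cmod (z\<^sup>2 + c) + cmod c"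
      by (metis add_diff_cancel_right' norm_triangle_ineq4)
    also have "\<dots> < 10" using z c by (auto simp: \<Omega>_def)
    finally have "(cmod z)\<^sup>2 < 4\<^sup>2" by (simp add: norm_power)
    then have z4: "cmod z < 4" using power2_less_imp_less by fastforce
    show "z \<in> (\<Omega> - A) \<union> thin"
    proof (cases "z \<in> cball z0 \<eta>")
      case True
      have "z\<^sup>2 + c - z0 = (z - z0) * (z + z0)"
        using fixed by (simp add: algebra_simps power2_eq_square)
      moreover have "\<eta> < cmod (z\<^sup>2 + c - z0)"
        using z by (simp add: \<Omega>_def dist_norm norm_minus_commute)
      ultimately have "\<eta> < cmod (z - z0) * cmod (z + z0)"
        by (simp only: norm_mult)
      also have "cmod (z + z0) \<le> 1 + \<eta>"
      proof -
        have "cmod (z + z0) = cmod ((z - z0) + 2 * z0)" by (simp add: algebra_simps)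
        also have "\<dots> \<le> cmod (z - z0) + cmod (2 * z0)" by (rule norm_triangle_ineq)
        finally show ?thesis using True neutral by (auto simp: dist_norm norm_minus_commute)
      qed
      then have "cmod (z - z0) * cmod (z + z0) \<le> cmod (z - z0) * (1 + \<eta>)"
        by (intro mult_left_mono) auto
      finally have "\<eta> / (1 + \<eta>) < cmod (z - z0)" using \<eta> by (simp add: field_simps)
      then show ?thesis using True by (auto simp: thin_def dist_norm norm_minus_commute)
    next
      case False
      then show ?thesis using z4 A_disj by (auto simp: \<Omega>_def)
    qed
  qed
  have A\<Omega>: "A \<subseteq> \<Omega>"
  proof
    fix z assume z: "z \<in> A"
    then have "4 \<le> cmod z" using A_disj by force
    moreover have "cmod z \<le> cmod z0 + cmod (z - z0)" using norm_triangle_sub by blast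
    ultimately have "\<not> cmod (z - z0) \<le> \<eta>" using z0 \<eta> by linarith
    then show "z \<in> \<Omega>" using z A_sub by (auto simp: \<Omega>_def dist_norm norm_minus_commute)
  qed
  \<comment> \<open>On the rim \<open>\<psi>\<close> is of order \<open>M / \<eta>^2\<close> while
    the area is of order \<open>\<eta>^3\<close>, which gives a total of order
    \<open>M * \<eta>\<close>.\<close>
  have thin: "I thin \<le> ennreal e"
  proof -
    have t: "0 < \<eta> / (1 + \<eta>)" "\<eta> / (1 + \<eta>) \<le> \<eta>"
      using \<eta> by (auto simp: field_simps)
    have "I thin \<le> (\<integral>\<^sup>+z. ennreal (M * (1 + \<eta>)\<^sup>2 / \<eta>\<^sup>2) * indicator thin z \<partial>lborel)"
      unfolding I_def
    proof (intro nn_integral_mono)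
      fix z
      have "cmod (\<psi> z) \<le> M * (1 + \<eta>)\<^sup>2 / \<eta>\<^sup>2" if z: "z \<in> thin"
      proof -
        have d: "\<eta> / (1 + \<eta>) < cmod (z - z0)" "cmod (z - z0) \<le> \<eta>"
          using z by (auto simp: thin_def dist_norm norm_minus_commute)
        then have "cmod (\<psi> z) \<le> M / (cmod (z - z0))\<^sup>2"
          using t \<eta> by (intro pole) linarith+
        also have "\<dots> \<le> M / (\<eta> / (1 + \<eta>))\<^sup>2"
        proof (rule divide_left_mono[OF _ M])
          show sq: "(\<eta> / (1 + \<eta>))\<^sup>2 \<le> (cmod (z - z0))\<^sup>2"
            using t d by (intro power_mono) linarith+
          have "0 < (\<eta> / (1 + \<eta>))\<^sup>2" using t(1) by (rule zero_less_power)
          with sq show "0 < (cmod (z - z0))\<^sup>2 * (\<eta> / (1 + \<eta>))\<^sup>2"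
            by (metis less_le_trans mult_pos_pos)
        qed
        finally show ?thesis by (simp add: power_divide)
      qed
      then show "ennreal (cmod (\<psi> z)) * indicator thin z \<le> ennreal (M * (1 + \<eta>)\<^sup>2 / \<eta>\<^sup>2) * indicator thin z"
        by (auto split: split_indicator intro!: ennreal_leI)
    qed
    also have "\<dots> = ennreal (M * (1 + \<eta>)\<^sup>2 / \<eta>\<^sup>2) * emeasure lborel thin"
      by (rule nn_integral_cmult_indicator) simp
    also have "emeasure lborel thin = ennreal (pi * \<eta>\<^sup>2 - pi * (\<eta> / (1 + \<eta>))\<^sup>2)"
      unfolding thin_def using t \<eta>
      by (subst emeasure_Diff) (auto simp: emeasure_cball unit_ball_vol_2 ennreal_minus)
    also have "ennreal (M * (1 + \<eta>)\<^sup>2 / \<eta>\<^sup>2) * \<dots> = ennreal (M * (1 + \<eta>)\<^sup>2 / \<eta>\<^sup>2 * (pi * \<eta>\<^sup>2 - pi * (\<eta> / (1 + \<eta>))\<^sup>2))"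
      using M by (intro ennreal_mult'[symmetric]) auto
    also have "M * (1 + \<eta>)\<^sup>2 / \<eta>\<^sup>2 * (pi * \<eta>\<^sup>2 - pi * (\<eta> / (1 + \<eta>))\<^sup>2) = pi * M * ((1 + \<eta>)\<^sup>2 - 1)"
      using \<eta> by (simp add: power_divide field_simps)
    also have "\<dots> \<le> pi * M * (8 * \<eta>)"
    proof (intro mult_left_mono)
      have "\<eta> * \<eta> \<le> \<eta> * 1" using \<eta> by (intro mult_left_mono) auto
      then show "(1 + \<eta>)\<^sup>2 - 1 \<le> 8 * \<eta>" using \<eta> by (simp add: power2_eq_square algebra_simps)
    qed (use M in auto)
    also have "\<dots> \<le> e" using \<eta>(4) by (simp add: mult_ac)
    finally show ?thesis by (simp add: ennreal_leI)
  qed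
  \<comment> \<open>The mass on \<open>\<Omega>\<close> is compared with the mass on its preimage,
    which omits \<open>A\<close> and adds only the rim; what \<open>A\<close> holds must therefore
    be paid for by \<open>h\<close> and the rim.\<close>
  have "I \<Omega> \<le> (\<integral>\<^sup>+z. ennreal (cmod (\<psi> z + h z)) * indicator \<Omega> z + ennreal (cmod (h z)) * indicator (ball 0 9) z \<partial>lborel)"
    unfolding I_def
  proof (intro nn_integral_mono)
    fix z
    have "cmod (\<psi> z) \<le> cmod (\<psi> z + h z) + cmod (h z)"
      by (metis add_diff_cancel_right' norm_triangle_ineq4)
    then have "ennreal (cmod (\<psi> z)) \<le> ennreal (cmod (\<psi> z + h z)) + ennreal (cmod (h z))"
      by (simp add: ennreal_plus[symmetric] ennreal_leI del: ennreal_plus)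
    then show "ennreal (cmod (\<psi> z)) * indicator \<Omega> z
        \<le> ennreal (cmod (\<psi> z + h z)) * indicator \<Omega> z + ennreal (cmod (h z)) * indicator (ball 0 9) z"
      by (auto simp: \<Omega>_def split: split_indicator)
  qed
  also have "\<dots> = (\<integral>\<^sup>+z. ennreal (cmod (\<psi> z + h z)) * indicator \<Omega> z \<partial>lborel) + ?H"
    by (rule nn_integral_add) measurable
  also have "(\<integral>\<^sup>+z. ennreal (cmod (\<psi> z + h z)) * indicator \<Omega> z \<partial>lborel)
      \<le> (\<integral>\<^sup>+z. ennreal (cmod (\<psi> z)) * indicator \<Omega> (z\<^sup>2 + c) \<partial>lborel)"
    by (rule nn_integral_pushforward_le[OF \<psi> h _ eq]) simp
  also have "\<dots> = I {z. z\<^sup>2 + c \<in> \<Omega>}"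
    unfolding I_def by (intro nn_integral_cong) (auto split: split_indicator)
  also have "\<dots> \<le> I ((\<Omega> - A) \<union> thin)"
    by (rule I_mono[OF preimage])
  also have "\<dots> \<le> I (\<Omega> - A) + I thin"
    by (rule I_Un) measurable
  finally have "I \<Omega> \<le> I (\<Omega> - A) + I thin + ?H"
    by (auto intro: add_right_mono)
  moreover have "I (\<Omega> - A) + I A = I \<Omega>"
    using A\<Omega> by (subst I_Un_disj) (auto intro!: arg_cong[where f = I])
  ultimately have "I (\<Omega> - A) + I A \<le> I (\<Omega> - A) + (I thin + ?H)"
    by (simp add: add.assoc)
  \<comment> \<open>Integrability away from the double pole permits cancelling this common
    term.\<close>
  moreover have "I (\<Omega> - A) < \<infinity>"
    using fin[OF \<eta>(1)] I_mono[of "\<Omega> - A" \<Omega>] unfolding I_def \<Omega>_def by (auto intro: le_less_trans)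
  ultimately have "I A \<le> I thin + ?H"
    by (auto simp: ennreal_add_left_cancel_le)
  also have "\<dots> \<le> ?H + ennreal e"
    using thin by (simp add: add.commute add_left_mono)
  finally show "(\<integral>\<^sup>+z. ennreal (cmod (\<psi> z)) * indicator A z \<partial>lborel) \<le> ?H + ennreal e"
    unfolding I_def .
qed

section \<open>The mean value property of polynomials, in discrete form and on an annulus\<close>

lemma sum_poly_rotations:
  fixes p :: "complex poly"
  assumes "degree p < m"
  defines "\<omega> \<equiv> exp (2 * of_real pi * \<i> / of_nat m)"
  shows "(\<Sum>k<m. poly p (a + \<omega> ^ k * x)) = of_nat m * poly p a"
proof -
  define q where "q = pcompose p [:a, 1:]"
  have q: "poly p (a + y) = poly q y" for y
    by (simp add: q_def poly_pcompose)
  have deg: "degree q = degree p"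
    by (simp add: q_def degree_pcompose)
  have \<omega>: "\<omega> ^ i = exp (2 * of_real pi * \<i> * of_nat i / of_nat m)" for i
    unfolding \<omega>_def by (simp add: exp_of_nat_mult[symmetric] mult_ac)
  have "(\<Sum>k<m. poly p (a + \<omega> ^ k * x)) = (\<Sum>k<m. \<Sum>i\<le>degree q. coeff q i * (\<omega> ^ k * x) ^ i)"
    unfolding q by (simp only: poly_altdef)
  also have "\<dots> = (\<Sum>i\<le>degree q. \<Sum>k<m. coeff q i * (\<omega> ^ k * x) ^ i)"
    by (rule sum.swap)
  also have "\<dots> = (\<Sum>i\<le>degree q. coeff q i * x ^ i * (\<Sum>k<m. (\<omega> ^ i) ^ k))"
    by (intro sum.cong refl)
      (simp add: sum_distrib_left power_mult_distrib mult_ac power_mult[symmetric])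
  also have "\<dots> = (\<Sum>i\<le>degree q. if i = 0 then coeff q 0 * of_nat m else 0)"
  proof (intro sum.cong refl)
    fix i assume i: "i \<in> {..degree q}"
    \<comment> \<open>As \<open>i \<le> degree p < m\<close>, the number \<open>\<omega> ^ i\<close>
      is an \<open>m\<close>-th root of unity other than 1, so its powers sum to 0 and only the
      constant term survives.\<close>
    have "(\<Sum>k<m. (\<omega> ^ i) ^ k) = 0" if "i \<noteq> 0"
    proof -
      have "\<omega> ^ i \<noteq> 1"
        unfolding \<omega> using i that deg assms(1) complex_root_unity_eq_1[of m i] by (auto dest: dvd_imp_le)
      moreover have "(\<omega> ^ i) ^ m = 1"
        using assms(1) complex_root_unity[of m i] by (simp add: \<omega>)
      ultimately show ?thesis by (simp add: geometric_sum)
    qed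
    then show "coeff q i * x ^ i * (\<Sum>k<m. (\<omega> ^ i) ^ k) = (if i = 0 then coeff q 0 * of_nat m else 0)"
      by auto
  qed
  also have "\<dots> = of_nat m * poly p a"
    using q[of 0] by (simp add: poly_0_coeff_0 mult.commute)
  finally show ?thesis .
qed

text \<open>Finitely many rotations replace the circle average: they preserve the annulus and area,
  and their mean is exactly \<open>poly p a\<close>. The factor \<open>pi\<close> is a crude lower
  bound for the area, since the annulus contains a unit disc.\<close>

lemma nn_integral_annulus_poly_ge:
  fixes p :: "complex poly"
  shows "ennreal (pi * cmod (poly p a))
       \<le> (\<integral>\<^sup>+z. ennreal (cmod (poly p z)) * indicator (ball a 7 - cball a 5) z \<partial>lborel)"
proof -
  define m where "m = Suc (degree p)"
  define \<omega> where "\<omega> = exp (2 * of_real pi * \<i> / of_nat m)"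
  let ?U = "ball a 7 - cball a 5"
  let ?f = "\<lambda>z. ennreal (cmod (poly p z)) * indicator ?U z"
  have [measurable]: "poly p \<in> borel_measurable borel"
    by (intro borel_measurable_continuous_onI continuous_intros)
  have [measurable]: "?U \<in> sets borel" by auto
  have f: "?f \<in> borel_measurable borel" by measurable
  have \<omega>: "cmod (\<omega> ^ k) = 1" for k
    by (simp add: \<omega>_def norm_power)
  have "ball (a + 6) 1 \<subseteq> ?U"
  proof
    fix z assume "z \<in> ball (a + 6) 1"
    then have z: "cmod ((z - a) - 6) < 1" by (simp add: dist_norm norm_minus_commute algebra_simps)
    then show "z \<in> ?U"
      using norm_triangle_ineq2[of "z - a" 6] norm_triangle_ineq3[of "z - a" 6]
      by (simp add: dist_norm norm_minus_commute)
  qed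
  then have "emeasure lborel (ball (a + 6) 1) \<le> emeasure lborel ?U"
    by (intro emeasure_mono) auto
  then have area: "ennreal pi \<le> emeasure lborel ?U"
    by (simp add: emeasure_ball unit_ball_vol_2)
  have "ennreal m * ennreal (pi * cmod (poly p a)) \<le> ennreal m * (ennreal (cmod (poly p a)) * emeasure lborel ?U)"
  proof (intro mult_left_mono)
    have "ennreal (pi * cmod (poly p a)) = ennreal (cmod (poly p a)) * ennreal pi"
      by (simp add: ennreal_mult[symmetric] mult.commute)
    also have "\<dots> \<le> ennreal (cmod (poly p a)) * emeasure lborel ?U"
      by (rule mult_left_mono[OF area]) simp
    finally show "ennreal (pi * cmod (poly p a)) \<le> ennreal (cmod (poly p a)) * emeasure lborel ?U" .
  qed simp
  also have "\<dots> = (\<integral>\<^sup>+z. ennreal (m * cmod (poly p a)) * indicator ?U z \<partial>lborel)"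
    by (subst nn_integral_cmult_indicator) (auto simp: ennreal_mult mult.assoc)
  also have "\<dots> \<le> (\<integral>\<^sup>+z. (\<Sum>k<m. ?f (a + \<omega> ^ k * (z - a))) \<partial>lborel)"
  proof (intro nn_integral_mono)
    fix z
    have "m * cmod (poly p a) = cmod (\<Sum>k<m. poly p (a + \<omega> ^ k * (z - a)))"
      unfolding \<omega>_def by (subst sum_poly_rotations) (simp_all add: m_def norm_mult del: of_nat_Suc)
    also have "\<dots> \<le> (\<Sum>k<m. cmod (poly p (a + \<omega> ^ k * (z - a))))"
      by (rule norm_sum)
    finally have "ennreal (m * cmod (poly p a)) \<le> (\<Sum>k<m. ennreal (cmod (poly p (a + \<omega> ^ k * (z - a)))))"
      by (simp add: sum_ennreal ennreal_leI)
    moreover have "a + \<omega> ^ k * (z - a) \<in> ?U \<longleftrightarrow> z \<in> ?U" for k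
      using \<omega>[of k] by (simp add: dist_norm norm_minus_commute norm_mult)
    ultimately show "ennreal (m * cmod (poly p a)) * indicator ?U z \<le> (\<Sum>k<m. ?f (a + \<omega> ^ k * (z - a)))"
      by (simp add: indicator_def)
  qed
  also have "\<dots> = (\<Sum>k<m. \<integral>\<^sup>+z. ?f (a + \<omega> ^ k * (z - a)) \<partial>lborel)"
    by (rule nn_integral_sum) measurable
  also have "\<dots> = (\<Sum>k<m. \<integral>\<^sup>+z. ?f z \<partial>lborel)"
    by (intro sum.cong refl nn_integral_rotate[OF f \<omega>])
  also have "\<dots> = ennreal m * (\<integral>\<^sup>+z. ?f z \<partial>lborel)"
    by (simp add: ennreal_of_nat_eq_real_of_nat)
  finally show ?thesis
    by (subst (asm) ennreal_mult_le_mult_iff) (auto simp: m_def)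
qed

section \<open>Periodic orbits and multipliers\<close>

lemma minimal_period_inj_on:
  assumes "has_minimal_period f n p"
  shows "inj_on (\<lambda>i. (f ^^ i) p) {..<n}"
proof -
  have *: "(f ^^ i) p \<noteq> (f ^^ j) p" if "i < j" "j < n" for i j
  proof
    assume eq: "(f ^^ i) p = (f ^^ j) p"
    have "(f ^^ (n - j + i)) p = (f ^^ (n - j)) ((f ^^ j) p)"
      by (simp add: funpow_add eq)
    also have "\<dots> = (f ^^ n) p"
      using that by (simp flip: funpow_add comp_apply[of "f ^^ (n - j)"])
    also have "\<dots> = p"
      using assms by (simp add: has_minimal_period_def)
    finally show False
      using assms that unfolding has_minimal_period_def
      by (metis add_pos_nonneg diff_add_inverse2 le_add_diff_inverse2 less_imp_le_nat nat_add_left_cancel_less zero_less_diff zero_le)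
  qed
  show ?thesis
    by (rule inj_onI) (metis * lessThan_iff linorder_neqE_nat)
qed

lemma periodic_orbit_eq_image: "periodic_orbit f n p = (\<lambda>i. (f ^^ i) p) ` {..<n}"
  unfolding periodic_orbit_def by auto

lemma card_periodic_orbit:
  "has_minimal_period f n p \<Longrightarrow> card (periodic_orbit f n p) = n"
  unfolding periodic_orbit_eq_image by (simp add: card_image minimal_period_inj_on)

lemma finite_periodic_orbit: "finite (periodic_orbit f n p)"
  unfolding periodic_orbit_eq_image by simp

lemma funpow_in_periodic_orbit:
  assumes "has_minimal_period f n p"
  shows "(f ^^ i) p \<in> periodic_orbit f n p"
proof -
  have "(f ^^ i) p = (f ^^ (i mod n)) p" "n > 0"
    using assms funpow_mod_eq[of n f p i] by (auto simp: has_minimal_period_def)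
  then show ?thesis unfolding periodic_orbit_def by auto
qed

text \<open>Any point of a cycle may serve as its base point; this later moves the base to the point
  farthest from \<open>z0\<close>. One inclusion and equal cardinality give equality of the
  orbits.\<close>

lemma periodic_orbit_shift:
  assumes p: "has_minimal_period f n p" and y: "y \<in> periodic_orbit f n p"
  shows "has_minimal_period f n y" "periodic_orbit f n y = periodic_orbit f n p"
proof -
  from y obtain k where k: "k < n" "y = (f ^^ k) p"
    unfolding periodic_orbit_def by auto
  have per: "(f ^^ n) p = p" and n: "n > 0" using p by (auto simp: has_minimal_period_def)
  have add: "(f ^^ i) ((f ^^ j) x) = (f ^^ (i + j)) x" for i j x
    by (simp add: funpow_add)
  show mp: "has_minimal_period f n y"
    unfolding has_minimal_period_def
  proof (intro conjI allI impI)
    show "n > 0" by (rule n)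
    show "(f ^^ n) y = y"
      unfolding k add by (metis add add.commute per)
    fix j assume j: "0 < j \<and> j < n"
    show "(f ^^ j) y \<noteq> y"
    proof
      assume "(f ^^ j) y = y"
      then have "(f ^^ (j + k)) p = (f ^^ k) p"
        unfolding k add .
      then have "(f ^^ (n - k)) ((f ^^ (j + k)) p) = (f ^^ (n - k)) ((f ^^ k) p)"
        by simp
      then have "(f ^^ (j + n)) p = (f ^^ n) p"
        using k unfolding add by (simp add: add.commute)
      then have "(f ^^ j) p = p"
        by (metis add per)
      then show False using p j by (auto simp: has_minimal_period_def)
    qed
  qed
  have "periodic_orbit f n y \<subseteq> periodic_orbit f n p"
  proof
    fix w assume "w \<in> periodic_orbit f n y"
    then obtain i where "w = (f ^^ (i + k)) p"
      unfolding periodic_orbit_def k add by auto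
    then have "w = (f ^^ ((i + k) mod n)) p"
      using funpow_mod_eq[OF per] by metis
    then show "w \<in> periodic_orbit f n p"
      unfolding periodic_orbit_def using n by auto
  qed
  then show "periodic_orbit f n y = periodic_orbit f n p"
    using card_periodic_orbit[OF mp] card_periodic_orbit[OF p] finite_periodic_orbit
    by (metis card_subset_eq)
qed

lemma periodic_orbits_disjoint:
  assumes "has_minimal_period f n p" "has_minimal_period f n q"
    and "periodic_orbit f n p \<noteq> periodic_orbit f n q"
  shows "periodic_orbit f n p \<inter> periodic_orbit f n q = {}"
  using assms periodic_orbit_shift(2) by (metis disjoint_iff)

lemma start_in_periodic_orbit: "n > 0 \<Longrightarrow> p \<in> periodic_orbit f n p"
  unfolding periodic_orbit_def by (auto intro!: exI[of _ 0])

text \<open>As a point of the cycle, \<open>z\<close> would itself have minimal period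
  \<open>n\<close>, against \<open>f z = z\<close> and \<open>n > 1\<close>.\<close>

lemma fixed_notin_periodic_orbit:
  assumes "has_minimal_period f n p" "n > 1" "f z = z"
  shows "z \<notin> periodic_orbit f n p"
proof
  assume "z \<in> periodic_orbit f n p"
  then have "has_minimal_period f n z" using assms periodic_orbit_shift by metis
  then show False using assms unfolding has_minimal_period_def
    by (metis funpow_0 funpow.simps(2) One_nat_def comp_apply zero_less_one)
qed

section \<open>Iterates as polynomials, and an upper bound for the multiplier\<close>

lemma poly_eq_prod_roots_times:
  fixes F :: "'a :: idom poly"
  assumes "finite S" "\<And>s. s \<in> S \<Longrightarrow> poly F s = 0"
  shows "\<exists>U. F = (\<Prod>s\<in>S. [:-s, 1:]) * U"
  using assms
proof (induction S rule: finite_induct)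
  case (insert s S)
  then obtain U where U: "F = (\<Prod>s\<in>S. [:-s, 1:]) * U" by auto
  have "poly (\<Prod>s\<in>S. [:-s, 1:]) s \<noteq> 0"
    using insert by (auto simp: poly_prod)
  moreover have "poly F s = 0" using insert by auto
  ultimately have "poly U s = 0" by (simp add: U)
  then obtain V where "U = [:-s, 1:] * V" by (metis dvdE poly_eq_0_iff_dvd)
  then have "F = (\<Prod>s\<in>insert s S. [:-s, 1:]) * V"
    by (simp only: U \<open>U = [:-s, 1:] * V\<close> prod.insert[OF insert(1,2)] mult_ac)
  then show ?case by blast
qed auto

text \<open>The polynomial form lets periodic points be divided out as roots; the quotient is again
  a polynomial and obeys the maximum principle.\<close>

fun iter_poly :: "complex \<Rightarrow> nat \<Rightarrow> complex poly" where
  "iter_poly c 0 = [:0, 1:]"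
| "iter_poly c (Suc k) = (iter_poly c k)\<^sup>2 + [:c:]"

lemma poly_iter_poly: "poly (iter_poly c k) z = ((\<lambda>z. z\<^sup>2 + c) ^^ k) z"
  by (induction k) (simp_all add: poly_power)

text \<open>Chain rule along the orbit; at a point of minimal period \<open>k\<close> this is the
  multiplier of its cycle.\<close>

lemma poly_pderiv_iter_poly:
  "poly (pderiv (iter_poly c k)) z = (\<Prod>i<k. 2 * ((\<lambda>z. z\<^sup>2 + c) ^^ i) z)"
  by (induction k) (simp_all add: pderiv_add pderiv_power pderiv_pCons poly_iter_poly power2_eq_square pderiv_mult mult_ac)

lemma power_one_plus_le_2:
  assumes "n > 0" "k \<le> n"
  shows "(1 + 1 / (2 * real n)) ^ k \<le> 2"
proof -
  have "(1 + 1 / (2 * real n)) ^ k \<le> exp (1 / (2 * real n)) ^ k"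
    by (intro power_mono) auto
  also have "\<dots> = exp (real k * (1 / (2 * real n)))"
    by (simp only: exp_of_nat_mult)
  also have "\<dots> \<le> exp (1 / 2)"
    using assms by (simp add: field_simps)
  also have "\<dots> \<le> 2"
    using exp_bound_half[of "1/2 :: real"] by simp
  finally show ?thesis .
qed

text \<open>Within \<open>1 / (2 * real n)\<close> of \<open>z0\<close>, one step multiplies the
  distance by at most \<open>1 + 1 / (2 * real n)\<close>. At most \<open>n\<close> such factors
  have product at most 2, which in turn keeps the orbit in that range.\<close>

lemma neutral_iterate_bound:
  assumes fixed: "z0\<^sup>2 + c = z0" and neutral: "cmod (2 * z0) = 1"
    and z: "cmod (z - z0) \<le> 1 / (4 * real n)" and n: "n > 0" and k: "k \<le> n"
  shows "cmod (((\<lambda>z. z\<^sup>2 + c) ^^ k) z - z0) \<le> 2 * cmod (z - z0)"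
proof -
  have "cmod (((\<lambda>z. z\<^sup>2 + c) ^^ k) z - z0) \<le> cmod (z - z0) * (1 + 1 / (2 * real n)) ^ k"
    using k
  proof (induction k)
    case (Suc k)
    define w where "w = ((\<lambda>z. z\<^sup>2 + c) ^^ k) z"
    have IH: "cmod (w - z0) \<le> cmod (z - z0) * (1 + 1 / (2 * real n)) ^ k"
      using Suc by (simp add: w_def)
    also have "\<dots> \<le> cmod (z - z0) * 2"
      using Suc.prems n by (intro mult_left_mono power_one_plus_le_2) auto
    also have "\<dots> \<le> 1 / (2 * real n)" using z by simp
    finally have w: "cmod (w - z0) \<le> 1 / (2 * real n)" .
    have "w\<^sup>2 + c - z0 = (w - z0) * ((w - z0) + 2 * z0)"
      using fixed by (simp add: algebra_simps power2_eq_square)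
    then have "cmod (w\<^sup>2 + c - z0) = cmod (w - z0) * cmod ((w - z0) + 2 * z0)"
      by (simp only: norm_mult)
    also have "\<dots> \<le> cmod (w - z0) * (1 + 1 / (2 * real n))"
      using w neutral norm_triangle_ineq[of "w - z0" "2 * z0"] by (intro mult_left_mono) auto
    also have "\<dots> \<le> (cmod (z - z0) * (1 + 1 / (2 * real n)) ^ k) * (1 + 1 / (2 * real n))"
      using IH by (intro mult_right_mono) auto
    finally show ?case by (simp add: w_def mult_ac)
  qed simp
  also have "\<dots> \<le> cmod (z - z0) * 2"
    using k n by (intro mult_left_mono power_one_plus_le_2) auto
  finally show ?thesis by simp
qed

text \<open>The polynomial of \<open>f\<^sup>n(z) - z\<close> is the product of all
  \<open>z - s\<close> times a cofactor \<open>U\<close>. Its derivative at the root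
  \<open>p\<close> is the product of the remaining \<open>p - s\<close> times \<open>U\<close> at
  \<open>p\<close>, and the maximum principle bounds \<open>U\<close>.\<close>

lemma multiplier_minus_one_bound:
  fixes z0 c p :: complex
  defines "f \<equiv> (\<lambda>z. z\<^sup>2 + c)"
  assumes fixed: "z0\<^sup>2 + c = z0" and neutral: "cmod (2 * z0) = 1" and n: "n > 0"
    and S: "finite S" "\<And>s. s \<in> S \<Longrightarrow> (f ^^ n) s = s" "\<And>s. s \<in> S \<Longrightarrow> cmod (s - z0) \<le> 1 / (8 * real n)"
    and p: "p \<in> S"
  shows "cmod ((\<Prod>i<n. 2 * (f ^^ i) p) - 1)
       \<le> (\<Prod>s\<in>S - {p}. cmod (p - s)) * (3 / (4 * real n) * (8 * real n) ^ card S)"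
proof -
  define F where "F = iter_poly c n - [:0, 1:]"
  have F: "poly F z = (f ^^ n) z - z" for z
    by (simp add: F_def poly_iter_poly f_def)
  obtain U where U: "F = (\<Prod>s\<in>S. [:-s, 1:]) * U"
    using poly_eq_prod_roots_times[of S F] S by (auto simp: F)
  \<comment> \<open>On the circle of radius \<open>R\<close> the \<open>n\<close>-th iterate stays
    within \<open>2 * R\<close> of \<open>z0\<close>, so \<open>|F| \<le> 3 * R\<close> there, while
    all roots in \<open>S\<close> lie within \<open>R / 2\<close> of the centre.\<close>
  define R where "R = 1 / (4 * real n)"
  have R: "R > 0" using n by (simp add: R_def)
  have U_bound: "cmod (poly U p) \<le> 3 * R * (2 / R) ^ card S"
  proof (rule maximum_modulus_frontier[of "poly U" "cball z0 R"])
    show "poly U holomorphic_on interior (cball z0 R)" by (intro holomorphic_intros)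
    show "continuous_on (closure (cball z0 R)) (poly U)" by (intro continuous_intros)
    show "p \<in> cball z0 R" using S(3)[OF p] n by (simp add: dist_norm norm_minus_commute R_def field_simps)
    fix z assume "z \<in> frontier (cball z0 R)"
    then have z: "cmod (z - z0) = R" using R by (simp add: frontier_cball dist_norm norm_minus_commute)
    have far: "R / 2 \<le> cmod (z - s)" if "s \<in> S" for s
    proof -
      have "cmod (s - z0) \<le> R / 2" using S(3)[OF that] by (simp add: R_def)
      moreover have "cmod (z - z0) \<le> cmod (z - s) + cmod (s - z0)"
        using norm_triangle_ineq[of "z - s" "s - z0"] by simp
      ultimately show ?thesis using z by simp
    qed
    have "(R / 2) ^ card S = (\<Prod>s\<in>S. R / 2)" by simp
    also have "\<dots> \<le> (\<Prod>s\<in>S. cmod (z - s))"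
      using far R by (intro prod_mono) auto
    finally have prod: "(R / 2) ^ card S \<le> (\<Prod>s\<in>S. cmod (z - s))" .
    have "(R / 2) ^ card S * cmod (poly U z) \<le> (\<Prod>s\<in>S. cmod (z - s)) * cmod (poly U z)"
      using prod by (rule mult_right_mono) simp
    also have "\<dots> = cmod (poly F z)"
      by (simp add: U poly_prod norm_mult prod_norm)
    also have "\<dots> \<le> cmod ((f ^^ n) z - z0) + cmod (z - z0)"
      unfolding F using norm_triangle_ineq4[of "(f ^^ n) z - z0" "z - z0"] by simp
    also have "\<dots> \<le> 2 * R + R"
      using neutral_iterate_bound[OF fixed neutral, of z n n] z n by (simp add: f_def R_def)
    finally show "cmod (poly U z) \<le> 3 * R * (2 / R) ^ card S"
      using R by (simp add: field_simps power_divide)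
  qed auto
  have "(\<Prod>i<n. 2 * (f ^^ i) p) - 1 = poly (pderiv F) p"
    by (simp add: F_def pderiv_diff pderiv_pCons poly_pderiv_iter_poly f_def)
  \<comment> \<open>Isolating the factor that vanishes at \<open>p\<close> leaves a single term of
    the product rule.\<close>
  also have "F = [:-p, 1:] * ((\<Prod>s\<in>S - {p}. [:-s, 1:]) * U)"
    by (simp only: U prod.remove[OF S(1) p] mult.assoc)
  also have "poly (pderiv \<dots>) p = (\<Prod>s\<in>S - {p}. p - s) * poly U p"
    unfolding pderiv_mult[of "[:-p, 1:]"] by (simp add: pderiv_pCons poly_prod)
  finally have "cmod ((\<Prod>i<n. 2 * (f ^^ i) p) - 1) = (\<Prod>s\<in>S - {p}. cmod (p - s)) * cmod (poly U p)"
    by (simp add: norm_mult prod_norm)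
  also have "\<dots> \<le> (\<Prod>s\<in>S - {p}. cmod (p - s)) * (3 * R * (2 / R) ^ card S)"
    using U_bound by (intro mult_left_mono prod_nonneg) auto
  finally show ?thesis by (simp add: R_def)
qed

section \<open>Separation of a cycle from the fixed point\<close>

text \<open>In the variable \<open>w = z\<^sup>2 + c\<close>, a simple pole at \<open>a\<close> is
  carried to one at the image \<open>a\<^sup>2 + c\<close>, with the residue divided by the
  derivative \<open>2 * a\<close>. A compensating pole appears at the critical value, where
  \<open>w - c = z\<^sup>2\<close>.\<close>

lemma pushforward_simple_pole:
  fixes a z c :: complex
  assumes "a \<noteq> 0" "z \<noteq> 0" "z\<^sup>2 \<noteq> a\<^sup>2"
  shows "1 / (z - a) + 1 / (- z - a) = 4 * z\<^sup>2 * (1 / (2 * a) * (1 / (z\<^sup>2 + c - (a\<^sup>2 + c)) - 1 / z\<^sup>2))"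
proof -
  have "z - a \<noteq> 0" "- z - a \<noteq> 0" "z\<^sup>2 - a\<^sup>2 \<noteq> 0"
    using assms by (auto simp: power2_eq_square square_eq_iff[unfolded power2_eq_square] equation_minus_iff)
  have "1 / (z - a) + 1 / (- z - a) = 2 * a / (z\<^sup>2 - a\<^sup>2)"
    using \<open>z - a \<noteq> 0\<close> \<open>- z - a \<noteq> 0\<close> \<open>z\<^sup>2 - a\<^sup>2 \<noteq> 0\<close>
    by (simp add: divide_simps) (simp add: algebra_simps power2_eq_square)
  also have "\<dots> = 4 * z\<^sup>2 * (1 / (2 * a) * (1 / (z\<^sup>2 - a\<^sup>2) - 1 / z\<^sup>2))"
    using assms \<open>z\<^sup>2 - a\<^sup>2 \<noteq> 0\<close> by (simp add: divide_simps) (simp add: algebra_simps power2_eq_square)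
  finally show ?thesis by simp
qed

text \<open>The coefficient of a double pole at a fixed point is preserved, but a simple pole is
  created there. The residue \<open>s\<close> is chosen so that the simple part is reproduced too,
  which is possible because \<open>2 * z0 \<noteq> 1\<close>; only a pole at the critical value
  remains.\<close>

lemma pushforward_double_pole:
  fixes z0 z c :: complex
  assumes fixed: "z0\<^sup>2 + c = z0" and "z0 \<noteq> 0" "2 * z0 \<noteq> 1" "z \<noteq> 0" "z\<^sup>2 \<noteq> z0\<^sup>2"
  defines "s \<equiv> 1 / (z0 * (1 - 2 * z0))"
  shows "(1 / (z - z0)\<^sup>2 + s / (z - z0)) + (1 / (- z - z0)\<^sup>2 + s / (- z - z0))
       = 4 * z\<^sup>2 * ((1 / (z\<^sup>2 + c - z0)\<^sup>2 + s / (z\<^sup>2 + c - z0)) - s / z\<^sup>2)"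
proof -
  define w where "w = z\<^sup>2 - z0\<^sup>2"
  have w: "w \<noteq> 0" using assms by (simp add: w_def)
  have w_prod: "(z - z0) * (z + z0) = w" by (simp add: w_def algebra_simps power2_eq_square)
  then have nz: "z - z0 \<noteq> 0" "z + z0 \<noteq> 0" using w by auto
  have s: "s * (2 * z0 * (1 - 2 * z0)) = 2"
    using assms by (simp add: s_def)
  have ws: "z\<^sup>2 + c - z0 = w" using fixed by (simp add: w_def algebra_simps)
  have "1 / (z - z0)\<^sup>2 + 1 / (z + z0)\<^sup>2 = (2 * z\<^sup>2 + 2 * z0\<^sup>2) / w\<^sup>2"
    using nz by (simp add: w_prod[symmetric] divide_simps) (simp add: algebra_simps power2_eq_square)
  moreover have "1 / (z - z0) = 2 * z0 / w + 1 / (z + z0)"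
    using nz by (simp add: w_prod[symmetric] divide_simps)
  then have "s * (1 / (z - z0)) = s * (1 / (z + z0)) + s * (2 * z0 / w)"
    by (simp only: distrib_left[symmetric] diff_eq_eq add.commute)
  moreover have "1 / (- z - z0)\<^sup>2 = 1 / (z + z0)\<^sup>2" "s / (- z - z0) = - (s * (1 / (z + z0)))"
  proof -
    have m: "- z - z0 = - (z + z0)" by simp
    show "1 / (- z - z0)\<^sup>2 = 1 / (z + z0)\<^sup>2" "s / (- z - z0) = - (s * (1 / (z + z0)))"
      unfolding m power2_minus by (simp_all del: minus_add_distrib)
  qed
  ultimately have "(1 / (z - z0)\<^sup>2 + s / (z - z0)) + (1 / (- z - z0)\<^sup>2 + s / (- z - z0))
      = (2 * z\<^sup>2 + 2 * z0\<^sup>2) / w\<^sup>2 + s * (2 * z0 / w)"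
    by simp
  also have "(2 * z\<^sup>2 + 2 * z0\<^sup>2) / w\<^sup>2 = 4 * z\<^sup>2 / w\<^sup>2 - 2 / w"
    using w by (simp add: divide_simps) (simp add: w_def algebra_simps power2_eq_square)
  also have "2 / w = s * (2 * z0 * (1 - 2 * z0)) / w" by (simp add: s)
  also have "4 * z\<^sup>2 / w\<^sup>2 - s * (2 * z0 * (1 - 2 * z0)) / w + s * (2 * z0 / w) = 4 * z\<^sup>2 / w\<^sup>2 + s * (4 * z0\<^sup>2 / w)"
    using w by (simp add: divide_simps) (simp add: algebra_simps power2_eq_square)
  also have "4 * z0\<^sup>2 / w = 4 * z\<^sup>2 * (1 / w - 1 / z\<^sup>2)"
    using w \<open>z \<noteq> 0\<close> by (simp add: divide_simps) (simp add: w_def algebra_simps)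
  also have "4 * z\<^sup>2 / w\<^sup>2 + s * (4 * z\<^sup>2 * (1 / w - 1 / z\<^sup>2)) = 4 * z\<^sup>2 * ((1 / w\<^sup>2 + s / w) - s / z\<^sup>2)"
    by (simp only: divide_inverse mult_1_left) (simp only: algebra_simps)
  finally show ?thesis unfolding ws .
qed

text \<open>The weights are products of inverse derivatives, so the pole at \<open>x i\<close> with
  weight \<open>a i\<close> moves to \<open>x (Suc i)\<close> with exactly the weight
  \<open>a (Suc i)\<close>. The only mismatch appears when the cycle closes: weight
  \<open>a n\<close> arrives at \<open>x 0\<close>, where \<open>a 0 = 1\<close> is
  expected.\<close>

lemma cycle_pole_function_pushforward:
  fixes c z :: complex and x :: "nat \<Rightarrow> complex"
  assumes x: "\<And>i. x (Suc i) = (x i)\<^sup>2 + c" "x n = x 0" "\<And>i. x i \<noteq> 0"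
    and z: "z \<noteq> 0" "\<And>i. i < n \<Longrightarrow> z\<^sup>2 \<noteq> (x i)\<^sup>2"
  defines "a \<equiv> (\<lambda>i. \<Prod>j<i. 1 / (2 * x j))"
  shows "(\<Sum>i<n. a i / (z - x i)) + (\<Sum>i<n. a i / (- z - x i))
       = 4 * z\<^sup>2 * ((\<Sum>i<n. a i / (z\<^sup>2 + c - x i)) + (a n - 1) / (z\<^sup>2 + c - x 0) - (\<Sum>i<n. a (Suc i)) / z\<^sup>2)"
proof -
  have "(\<Sum>i<n. a i / (z - x i)) + (\<Sum>i<n. a i / (- z - x i))
      = (\<Sum>i<n. a i * (1 / (z - x i) + 1 / (- z - x i)))"
    by (simp add: sum.distrib[symmetric] algebra_simps)
  also have "\<dots> = (\<Sum>i<n. 4 * z\<^sup>2 * (a (Suc i) / (z\<^sup>2 + c - x (Suc i)) - a (Suc i) / z\<^sup>2))"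
  proof (intro sum.cong refl)
    fix i assume "i \<in> {..<n}"
    then have "1 / (z - x i) + 1 / (- z - x i) = 4 * z\<^sup>2 * (1 / (2 * x i) * (1 / (z\<^sup>2 + c - x (Suc i)) - 1 / z\<^sup>2))"
      unfolding x(1) by (intro pushforward_simple_pole x(3) z) auto
    moreover have "a (Suc i) = a i * (1 / (2 * x i))" by (simp add: a_def)
    moreover have "u * (v * (r * (P - Q))) = v * (u * r * P - u * r * Q)" for u v r P Q :: complex
      by (simp add: algebra_simps)
    moreover have "a (Suc i) / W = a (Suc i) * (1 / W)" for W by simp
    ultimately show "a i * (1 / (z - x i) + 1 / (- z - x i))
        = 4 * z\<^sup>2 * (a (Suc i) / (z\<^sup>2 + c - x (Suc i)) - a (Suc i) / z\<^sup>2)"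
      by (simp only:)
  qed
  also have "\<dots> = 4 * z\<^sup>2 * ((\<Sum>i<n. a (Suc i) / (z\<^sup>2 + c - x (Suc i))) - (\<Sum>i<n. a (Suc i)) / z\<^sup>2)"
    by (simp add: sum_distrib_left[symmetric] sum_subtractf sum_divide_distrib)
  also have "(\<Sum>i<n. a (Suc i) / (z\<^sup>2 + c - x (Suc i)))
      = (\<Sum>i<n. a i / (z\<^sup>2 + c - x i)) + (a n - 1) / (z\<^sup>2 + c - x 0)"
  proof -
    have "a 0 / (z\<^sup>2 + c - x 0) + (\<Sum>i<n. a (Suc i) / (z\<^sup>2 + c - x (Suc i)))
        = (\<Sum>i<n. a i / (z\<^sup>2 + c - x i)) + a n / (z\<^sup>2 + c - x n)"
      using sum.lessThan_Suc_shift[of "\<lambda>i. a i / (z\<^sup>2 + c - x i)" n] by simp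
    then show ?thesis by (simp add: x(2) a_def diff_divide_distrib algebra_simps)
  qed
  finally show ?thesis .
qed

text \<open>The escaping estimate bounds the mass of \<open>\<psi>\<close> on the annulus
  \<open>U\<close> by \<open>40 * pi * cmod \<epsilon>\<close>. Clearing the poles multiplies by
  \<open>n + 2\<close> linear factors, each at most 8 on \<open>U\<close>, and the mean value bound
  for the resulting polynomial at \<open>x 0\<close> gives the left-hand side.\<close>

lemma cycle_separation_bound:
  fixes c z0 :: complex and x :: "nat \<Rightarrow> complex"
  assumes fixed: "z0\<^sup>2 + c = z0" and neutral: "cmod (2 * z0) = 1" and not_one: "2 * z0 \<noteq> 1"
    and n: "n > 0"
    and x: "\<And>i. x (Suc i) = (x i)\<^sup>2 + c" "x n = x 0" "inj_on x {..<n}"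
    and near: "\<And>i. cmod (x i - z0) \<le> 1 / 4" and xz0: "\<And>i. x i \<noteq> z0"
  shows "(cmod (x 0 - z0))\<^sup>2 * (\<Prod>j\<in>{..<n} - {0}. cmod (x 0 - x j))
       \<le> 40 * 8 ^ (n + 2) * cmod ((\<Prod>j<n. 1 / (2 * x j)) - 1)"
proof -
  define a where "a = (\<lambda>i. \<Prod>j<i. 1 / (2 * x j))"
  define s where "s = 1 / (z0 * (1 - 2 * z0))"
  define L where "L = (\<Sum>i<n. a (Suc i))"
  \<comment> \<open>this choice cancels the pole of the pushforward at the critical value \<open>c\<close>\<close>
  define \<kappa> where "\<kappa> = L / s"
  define \<psi> where "\<psi> = (\<lambda>z. (\<Sum>i<n. a i / (z - x i)) - \<kappa> * (1 / (z - z0)\<^sup>2 + s / (z - z0)))"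
  \<comment> \<open>Here \<open>a n\<close> is the inverse of the multiplier of the cycle.\<close>
  define \<epsilon> where "\<epsilon> = a n - 1"
  define h where "h = (\<lambda>z. \<epsilon> / (z - x 0))"
  \<comment> \<open>As \<open>cmod (x 0) \<le> 3 / 4\<close>, these radii place \<open>U\<close>
    inside \<open>ball 0 9\<close> and outside \<open>ball 0 4\<close>, as the escaping estimate
    demands.\<close>
  define U where "U = ball (x 0) 7 - cball (x 0) 5"
  have [measurable]: "U \<in> sets borel" "ball (0::complex) 9 \<in> sets borel" by (auto simp: U_def)
  have z0: "cmod z0 = 1 / 2" using neutral by (simp add: norm_mult)
  have z0_nz: "z0 \<noteq> 0" using z0 by auto
  have s: "s \<noteq> 0" using not_one z0_nz by (simp add: s_def)
  have x_lower: "1 / 4 \<le> cmod (x i)" and x_upper: "cmod (x i) \<le> 3 / 4" for i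
  proof -
    have "cmod z0 \<le> cmod (x i) + cmod (x i - z0)"
      using norm_triangle_ineq4[of "x i" "x i - z0"] by simp
    then show "1 / 4 \<le> cmod (x i)" using near[of i] z0 by simp
    show "cmod (x i) \<le> 3 / 4" using norm_triangle_sub[of "x i" z0] near[of i] z0 by simp
  qed
  have x_nz: "x i \<noteq> 0" for i using x_lower[of i] by auto
  have \<psi>_meas: "\<psi> \<in> borel_measurable borel" and h_meas: "h \<in> borel_measurable borel"
    unfolding \<psi>_def h_def by measurable

  have id: "\<psi> z + \<psi> (- z) = 4 * z\<^sup>2 * (\<psi> (z\<^sup>2 + c) + h (z\<^sup>2 + c))"
    if z: "z \<noteq> 0" "z\<^sup>2 \<noteq> z0\<^sup>2" "\<And>i. i < n \<Longrightarrow> z\<^sup>2 \<noteq> (x i)\<^sup>2" for z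
  proof -
    let ?D = "\<lambda>z. 1 / (z - z0)\<^sup>2 + s / (z - z0)"
    have 1: "(\<Sum>i<n. a i / (z - x i)) + (\<Sum>i<n. a i / (- z - x i))
       = 4 * z\<^sup>2 * ((\<Sum>i<n. a i / (z\<^sup>2 + c - x i)) + \<epsilon> / (z\<^sup>2 + c - x 0) - L / z\<^sup>2)"
      unfolding \<epsilon>_def L_def a_def
      by (rule cycle_pole_function_pushforward[OF x(1,2) x_nz z(1,3)])
    have 2: "?D z + ?D (- z) = 4 * z\<^sup>2 * (?D (z\<^sup>2 + c) - s / z\<^sup>2)"
      unfolding s_def by (rule pushforward_double_pole[OF fixed z0_nz not_one z(1,2)])
    have "\<kappa> * (s / z\<^sup>2) = L / z\<^sup>2" using s by (simp add: \<kappa>_def)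
    have "\<psi> z + \<psi> (- z) = ((\<Sum>i<n. a i / (z - x i)) + (\<Sum>i<n. a i / (- z - x i))) - \<kappa> * (?D z + ?D (- z))"
      unfolding \<psi>_def by (simp only: algebra_simps)
    also have "\<dots> = 4 * z\<^sup>2 * ((\<Sum>i<n. a i / (z\<^sup>2 + c - x i)) + \<epsilon> / (z\<^sup>2 + c - x 0) - L / z\<^sup>2)
        - \<kappa> * (4 * z\<^sup>2 * (?D (z\<^sup>2 + c) - s / z\<^sup>2))"
      by (simp only: 1 2)
    also have "\<dots> = 4 * z\<^sup>2 * ((\<Sum>i<n. a i / (z\<^sup>2 + c - x i)) - \<kappa> * ?D (z\<^sup>2 + c) + \<epsilon> / (z\<^sup>2 + c - x 0)
        - (L / z\<^sup>2 - \<kappa> * (s / z\<^sup>2)))"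
      by (simp only: right_diff_distrib distrib_left mult_ac) (simp only: algebra_simps)
    also have "\<dots> = 4 * z\<^sup>2 * (\<psi> (z\<^sup>2 + c) + h (z\<^sup>2 + c))"
      unfolding \<psi>_def h_def \<open>\<kappa> * (s / z\<^sup>2) = L / z\<^sup>2\<close> by simp
    finally show ?thesis .
  qed
  have AE: "AE z in lborel. \<psi> z + \<psi> (- z) = 4 * z\<^sup>2 * (\<psi> (z\<^sup>2 + c) + h (z\<^sup>2 + c))"
  proof -
    let ?S = "{0, z0, - z0} \<union> x ` {..<n} \<union> (\<lambda>i. - x i) ` {..<n}"
    have "AE z in lborel. z \<notin> ?S" by (intro AE_not_in finite_imp_null_set_lborel) auto
    then show ?thesis
      by (rule AE_mp) (intro AE_I2 impI id; auto simp: power2_eq_iff)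
  qed
  have bound: "cmod (\<psi> z) \<le> (\<Sum>i<n. cmod (a i) * (1 / cmod (z - x i)))
      + cmod \<kappa> * (1 / (cmod (z - z0))\<^sup>2 + cmod s / cmod (z - z0))" for z
  proof -
    have "cmod (\<psi> z) \<le> cmod (\<Sum>i<n. a i / (z - x i)) + cmod (\<kappa> * (1 / (z - z0)\<^sup>2 + s / (z - z0)))"
      unfolding \<psi>_def by (rule norm_triangle_ineq4)
    moreover have "cmod (\<Sum>i<n. a i / (z - x i)) \<le> (\<Sum>i<n. cmod (a i) * (1 / cmod (z - x i)))"
      by (rule order_trans[OF norm_sum]) (simp add: norm_divide)
    moreover have "cmod (\<kappa> * (1 / (z - z0)\<^sup>2 + s / (z - z0)))
        \<le> cmod \<kappa> * (1 / (cmod (z - z0))\<^sup>2 + cmod s / cmod (z - z0))"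
      unfolding norm_mult
      by (intro mult_left_mono order_trans[OF norm_triangle_ineq]) (simp_all add: norm_divide norm_power)
    ultimately show ?thesis by linarith
  qed
  have ball_sub: "ball 0 9 \<subseteq> ball (x i) 10" for i
  proof
    fix z :: complex assume "z \<in> ball 0 9"
    then show "z \<in> ball (x i) 10"
      using x_upper[of i] norm_triangle_ineq4[of z "x i"] by (simp add: dist_norm norm_minus_commute)
  qed
  \<comment> \<open>The radius 10, large enough to contain \<open>ball 0 9\<close> around every
    \<open>x i\<close>, is the source of the factor 40.\<close>
  have int: "(\<integral>\<^sup>+z. ennreal (1 / cmod (z - x i)) * indicator (ball 0 9) z \<partial>lborel) \<le> ennreal (4 * pi * 10)" for i
    using ball_sub[of i]
    by (intro order_trans[OF nn_integral_mono nn_integral_inverse_norm_le[of 10 "x i"]])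
      (auto split: split_indicator)
  \<comment> \<open>Off the removed disc the terms with poles at \<open>z0\<close> are bounded by
    the constant \<open>K\<close>, and the simple poles are integrable.\<close>
  have fin: "(\<integral>\<^sup>+z. ennreal (cmod (\<psi> z)) * indicator (ball 0 9 - cball z0 \<eta>) z \<partial>lborel) < \<infinity>"
    if \<eta>: "\<eta> > 0" for \<eta>
  proof -
    define K where "K = cmod \<kappa> * (1 / \<eta>\<^sup>2 + cmod s / \<eta>)"
    let ?g = "\<lambda>z. (\<Sum>i<n. ennreal (cmod (a i)) * (ennreal (1 / cmod (z - x i)) * indicator (ball 0 9) z))
        + ennreal K * indicator (ball 0 9) z"
    have "(\<integral>\<^sup>+z. ennreal (cmod (\<psi> z)) * indicator (ball 0 9 - cball z0 \<eta>) z \<partial>lborel) \<le> (\<integral>\<^sup>+z. ?g z \<partial>lborel)"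
    proof (intro nn_integral_mono)
      fix z
      show "ennreal (cmod (\<psi> z)) * indicator (ball 0 9 - cball z0 \<eta>) z \<le> ?g z"
      proof (cases "z \<in> ball 0 9 - cball z0 \<eta>")
        case True
        then have d: "\<eta> \<le> cmod (z - z0)" by (simp add: dist_norm norm_minus_commute)
        have "1 / (cmod (z - z0))\<^sup>2 \<le> 1 / \<eta>\<^sup>2" "cmod s / cmod (z - z0) \<le> cmod s / \<eta>"
          using d \<eta> by (auto intro!: divide_left_mono power_mono mult_pos_pos zero_less_power)
        then have "cmod \<kappa> * (1 / (cmod (z - z0))\<^sup>2 + cmod s / cmod (z - z0)) \<le> K"
          unfolding K_def by (intro mult_left_mono add_mono) auto
        then have "cmod (\<psi> z) \<le> (\<Sum>i<n. cmod (a i) * (1 / cmod (z - x i))) + K"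
          using bound[of z] by linarith
        then have "ennreal (cmod (\<psi> z)) \<le> ennreal ((\<Sum>i<n. cmod (a i) * (1 / cmod (z - x i))) + K)"
          by (rule ennreal_leI)
        also have "\<dots> = (\<Sum>i<n. ennreal (cmod (a i)) * ennreal (1 / cmod (z - x i))) + ennreal K"
        proof -
          have "0 \<le> K" using \<eta> by (simp add: K_def)
          then have "ennreal ((\<Sum>i<n. cmod (a i) * (1 / cmod (z - x i))) + K)
              = ennreal (\<Sum>i<n. cmod (a i) * (1 / cmod (z - x i))) + ennreal K"
            by (intro ennreal_plus sum_nonneg) simp_all
          also have "ennreal (\<Sum>i<n. cmod (a i) * (1 / cmod (z - x i)))
              = (\<Sum>i<n. ennreal (cmod (a i) * (1 / cmod (z - x i))))"
            by (rule sum_ennreal[symmetric]) simp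
          also have "\<dots> = (\<Sum>i<n. ennreal (cmod (a i)) * ennreal (1 / cmod (z - x i)))"
            by (intro sum.cong refl ennreal_mult) simp_all
          finally show ?thesis .
        qed
        finally show ?thesis using True by simp
      qed auto
    qed
    also have "\<dots> = (\<Sum>i<n. \<integral>\<^sup>+z. ennreal (cmod (a i)) * (ennreal (1 / cmod (z - x i)) * indicator (ball 0 9) z) \<partial>lborel)
        + (\<integral>\<^sup>+z. ennreal K * indicator (ball (0::complex) 9) z \<partial>lborel)"
    proof -
      have 1: "(\<lambda>z. ennreal (cmod (a i)) * (ennreal (1 / cmod (z - x i)) * indicator (ball 0 9) z)) \<in> borel_measurable lborel" for i
        by (intro borel_measurable_times_ennreal borel_measurable_indicator) simp_all
      have 2: "(\<lambda>z. ennreal K * indicator (ball (0::complex) 9) z) \<in> borel_measurable lborel"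
        by (intro borel_measurable_times_ennreal borel_measurable_indicator) simp_all
      show ?thesis
        by (simp only: nn_integral_add[OF borel_measurable_sum[OF 1] 2] nn_integral_sum[OF 1])
    qed
    also have "\<dots> < \<infinity>"
    proof -
      have "(\<integral>\<^sup>+z. ennreal (cmod (a i)) * (ennreal (1 / cmod (z - x i)) * indicator (ball 0 9) z) \<partial>lborel) < \<infinity>" for i
      proof -
        have "(\<integral>\<^sup>+z. ennreal (cmod (a i)) * (ennreal (1 / cmod (z - x i)) * indicator (ball 0 9) z) \<partial>lborel)
            = ennreal (cmod (a i)) * (\<integral>\<^sup>+z. ennreal (1 / cmod (z - x i)) * indicator (ball 0 9) z \<partial>lborel)"
          by (intro nn_integral_cmult borel_measurable_times_ennreal borel_measurable_indicator) simp_all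
        also have "\<dots> \<le> ennreal (cmod (a i)) * ennreal (4 * pi * 10)"
          by (intro mult_left_mono int) simp
        also have "\<dots> < \<infinity>" by (simp add: ennreal_mult_less_top)
        finally show ?thesis .
      qed
      moreover have "(\<integral>\<^sup>+z. ennreal K * indicator (ball (0::complex) 9) z \<partial>lborel) < \<infinity>"
        by (subst nn_integral_cmult_indicator) (auto simp: ennreal_mult_less_top emeasure_ball)
      ultimately show ?thesis by simp
    qed
    finally show ?thesis .
  qed
  \<comment> \<open>Half the distance from \<open>z0\<close> to the cycle keeps all simple poles at
    least \<open>\<eta>0\<close> away from the disc; the bound 1 lets lower powers of the distance
    be absorbed by the double pole.\<close>
  obtain \<eta>0 where \<eta>0: "0 < \<eta>0" "\<eta>0 \<le> 1" "\<And>i. i < n \<Longrightarrow> 2 * \<eta>0 \<le> cmod (x i - z0)"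
  proof
    define m where "m = Min ((\<lambda>i. cmod (x i - z0)) ` {..<n})"
    have "m \<in> (\<lambda>i. cmod (x i - z0)) ` {..<n}" unfolding m_def using n by (intro Min_in) auto
    then show "0 < min (m / 2) 1" using xz0 by auto
    show "min (m / 2) 1 \<le> 1" by simp
    show "2 * min (m / 2) 1 \<le> cmod (x i - z0)" if "i < n" for i
    proof -
      have "m \<le> cmod (x i - z0)" unfolding m_def using that by (intro Min_le) auto
      then show ?thesis by linarith
    qed
  qed
  define M where "M = (\<Sum>i<n. cmod (a i)) / \<eta>0 + cmod \<kappa> * (1 + cmod s)"
  have pole: "cmod (\<psi> z) \<le> M / (cmod (z - z0))\<^sup>2"
    if z: "0 < cmod (z - z0)" "cmod (z - z0) \<le> \<eta>0" for z
  proof -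
    define d where "d = cmod (z - z0)"
    have d: "0 < d" "d \<le> \<eta>0" using z by (simp_all add: d_def)
    have d2: "d\<^sup>2 \<le> 1" "d \<le> 1" using d \<eta>0 by (auto simp: power_le_one)
    have "(\<Sum>i<n. cmod (a i) * (1 / cmod (z - x i))) \<le> (\<Sum>i<n. cmod (a i) * (1 / \<eta>0))"
    proof (intro sum_mono mult_left_mono)
      fix i assume "i \<in> {..<n}"
      then have "2 * \<eta>0 \<le> cmod (x i - z0)" using \<eta>0 by auto
      moreover have "cmod (x i - z0) \<le> cmod (z - x i) + cmod (z - z0)"
        using norm_triangle_ineq4[of "z - z0" "z - x i"] by (simp add: norm_minus_commute algebra_simps)
      ultimately have "\<eta>0 \<le> cmod (z - x i)" using d by (simp add: d_def)
      then show "1 / cmod (z - x i) \<le> 1 / \<eta>0" using \<eta>0(1) by (intro divide_left_mono mult_pos_pos) linarith+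
    qed auto
    also have "\<dots> = (\<Sum>i<n. cmod (a i)) / \<eta>0" by (simp add: sum_divide_distrib)
    also have "\<dots> \<le> (\<Sum>i<n. cmod (a i)) / \<eta>0 / d\<^sup>2"
    proof -
      have "(\<Sum>i<n. cmod (a i)) / \<eta>0 * d\<^sup>2 \<le> (\<Sum>i<n. cmod (a i)) / \<eta>0"
        using d2 \<eta>0 by (intro mult_left_le) (simp_all add: sum_nonneg)
      then show ?thesis using d by (simp add: pos_le_divide_eq)
    qed
    finally have 1: "(\<Sum>i<n. cmod (a i) * (1 / cmod (z - x i))) \<le> (\<Sum>i<n. cmod (a i)) / \<eta>0 / d\<^sup>2" .
    have "cmod s / d \<le> cmod s / d\<^sup>2"
    proof (intro divide_left_mono mult_pos_pos zero_less_power)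
      show "d\<^sup>2 \<le> d" using d d2 by (simp add: power2_eq_square mult_left_le)
    qed (use d in simp_all)
    then have "1 / d\<^sup>2 + cmod s / d \<le> (1 + cmod s) / d\<^sup>2"
      by (simp add: add_divide_distrib)
    then have 2: "cmod \<kappa> * (1 / d\<^sup>2 + cmod s / d) \<le> cmod \<kappa> * ((1 + cmod s) / d\<^sup>2)"
      by (rule mult_left_mono) simp
    have "cmod (\<psi> z) \<le> (\<Sum>i<n. cmod (a i)) / \<eta>0 / d\<^sup>2 + cmod \<kappa> * ((1 + cmod s) / d\<^sup>2)"
      using bound[of z] 1 2 unfolding d_def by linarith
    then show ?thesis unfolding M_def d_def[symmetric] by (simp add: add_divide_distrib distrib_left)
  qed
  have U_far: "cmod (z - z0) \<le> 8 \<and> (\<forall>i. cmod (z - x i) \<le> 8) \<and> cmod z < 9 \<and> 4 < cmod z" if "z \<in> U" for z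
  proof -
    have d: "cmod (z - x 0) < 7" "5 < cmod (z - x 0)"
      using that by (auto simp: U_def dist_norm norm_minus_commute)
    have "cmod (z - z0) \<le> 8"
      using norm_triangle_ineq[of "z - x 0" "x 0 - z0"] d near[of 0] by simp
    moreover have "cmod (z - x i) \<le> 8" for i
    proof -
      have "cmod (x 0 - x i) \<le> 1 / 2"
        using norm_triangle_ineq4[of "x 0 - z0" "x i - z0"] near[of 0] near[of i] by simp
      then show ?thesis using norm_triangle_ineq[of "z - x 0" "x 0 - x i"] d by simp
    qed
    moreover have "cmod z < 9" "4 < cmod z"
      using norm_triangle_ineq[of "z - x 0" "x 0"] norm_triangle_ineq4[of z "x 0"] d x_upper[of 0] by simp_all
    ultimately show ?thesis by blast
  qed
  have U_sub: "U \<subseteq> ball 0 9" using U_far by auto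
  have U_disj: "U \<inter> ball 0 4 = {}"
  proof -
    have "z \<notin> ball 0 4" if "z \<in> U" for z using U_far[OF that] by auto
    then show ?thesis by blast
  qed
  have "(\<integral>\<^sup>+z. ennreal (cmod (\<psi> z)) * indicator U z \<partial>lborel)
      \<le> (\<integral>\<^sup>+z. ennreal (cmod (h z)) * indicator (ball 0 9) z \<partial>lborel)"
    by (rule nn_integral_escaping_le[OF \<psi>_meas h_meas _ U_sub U_disj fixed neutral AE fin \<eta>0(1) pole]) simp
  also have "\<dots> = (\<integral>\<^sup>+z. ennreal (cmod \<epsilon>) * (ennreal (1 / cmod (z - x 0)) * indicator (ball 0 9) z) \<partial>lborel)"
    by (intro nn_integral_cong) (simp add: h_def norm_divide ennreal_mult[symmetric] mult.assoc[symmetric])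
  also have "\<dots> = ennreal (cmod \<epsilon>) * (\<integral>\<^sup>+z. ennreal (1 / cmod (z - x 0)) * indicator (ball 0 9) z \<partial>lborel)"
    by (intro nn_integral_cmult borel_measurable_times_ennreal borel_measurable_indicator) simp_all
  also have "\<dots> \<le> ennreal (cmod \<epsilon>) * ennreal (4 * pi * 10)"
    by (intro mult_left_mono int) simp
  finally have \<psi>_U: "(\<integral>\<^sup>+z. ennreal (cmod (\<psi> z)) * indicator U z \<partial>lborel) \<le> ennreal (cmod \<epsilon> * (40 * pi))"
    by (simp add: ennreal_mult[symmetric] mult.commute)

  \<comment> \<open>\<open>(z - z0)\<^sup>2 * (\<Prod>j<n. z - x j) * \<psi> z\<close> with the poles cancelled\<close>
  define N where "N = [:-z0, 1:]\<^sup>2 * (\<Sum>i<n. smult (a i) (\<Prod>j\<in>{..<n} - {i}. [:-x j, 1:]))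
      - smult \<kappa> ((\<Prod>j<n. [:-x j, 1:]) * (1 + smult s [:-z0, 1:]))"
  have N_eval: "poly N z = (z - z0)\<^sup>2 * poly (\<Sum>i<n. smult (a i) (\<Prod>j\<in>{..<n} - {i}. [:-x j, 1:])) z
      - \<kappa> * (poly (\<Prod>j<n. [:-x j, 1:]) z * (1 + s * (z - z0)))" for z
  proof -
    have "poly (1 + smult s [:-z0, 1:]) z = 1 + s * (z - z0)"
      by (simp add: algebra_simps)
    moreover have "poly ([:-z0, 1:]\<^sup>2) z = (z - z0)\<^sup>2" by (simp add: poly_power)
    ultimately show ?thesis by (simp only: N_def poly_diff poly_mult poly_smult)
  qed
  have N: "poly N z = (z - z0)\<^sup>2 * (\<Prod>j<n. z - x j) * \<psi> z"
    if z: "z \<noteq> z0" "\<And>i. i < n \<Longrightarrow> z \<noteq> x i" for z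
  proof -
    have 1: "(\<Prod>j\<in>{..<n} - {i}. z - x j) = (\<Prod>j<n. z - x j) / (z - x i)" if "i < n" for i
      using z(2)[OF that] that by (subst prod.remove[of "{..<n}" i]) auto
    have "poly N z = (z - z0)\<^sup>2 * (\<Sum>i<n. a i * (\<Prod>j\<in>{..<n} - {i}. z - x j))
        - \<kappa> * ((\<Prod>j<n. z - x j) * (1 + s * (z - z0)))"
      by (simp only: N_eval poly_sum poly_smult poly_prod) simp
    also have "(\<Sum>i<n. a i * (\<Prod>j\<in>{..<n} - {i}. z - x j)) = (\<Prod>j<n. z - x j) * (\<Sum>i<n. a i / (z - x i))"
      unfolding sum_distrib_left by (intro sum.cong refl) (simp add: 1)
    also have "1 + s * (z - z0) = (z - z0)\<^sup>2 * (1 / (z - z0)\<^sup>2 + s / (z - z0))"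
    proof -
      have "1 + s * t = t\<^sup>2 * (1 / t\<^sup>2 + s / t)" if "t \<noteq> 0" for t
        using that by (simp add: distrib_left power2_eq_square)
      then show ?thesis using z(1) by simp
    qed
    finally show ?thesis unfolding \<psi>_def by (simp only: right_diff_distrib mult_ac)
  qed
  \<comment> \<open>The factored formula \<open>N\<close> excludes the pole \<open>x 0\<close>, so
    \<open>N\<close> is evaluated there in polynomial form: every product containing the factor of
    index 0 vanishes, and only the summand \<open>i = 0\<close> with \<open>a 0 = 1\<close>
    survives.\<close>
  have "poly (\<Prod>j<n. [:-x j, 1:]) (x 0) = 0"
    using n by (auto simp: poly_prod)
  moreover have "poly (\<Prod>j\<in>{..<n} - {i}. [:-x j, 1:]) (x 0) = 0" if "i \<in> {..<n} - {0}" for i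
    using n that by (auto simp: poly_prod)
  moreover have "poly N (x 0) = (x 0 - z0)\<^sup>2 * (\<Sum>i<n. a i * poly (\<Prod>j\<in>{..<n} - {i}. [:-x j, 1:]) (x 0))
      - \<kappa> * (poly (\<Prod>j<n. [:-x j, 1:]) (x 0) * (1 + s * (x 0 - z0)))"
    by (simp only: N_eval poly_sum poly_smult)
  ultimately have "poly N (x 0) = (x 0 - z0)\<^sup>2 *
      (\<Sum>i<n. a i * (if i = 0 then poly (\<Prod>j\<in>{..<n} - {0}. [:-x j, 1:]) (x 0) else 0))"
    by (simp, intro disjI2 sum.cong) auto
  also have "\<dots> = (x 0 - z0)\<^sup>2 * (a 0 * poly (\<Prod>j\<in>{..<n} - {0}. [:-x j, 1:]) (x 0))"
    using n by (simp add: if_distrib[of "\<lambda>y. _ * y"] cong: if_cong)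
  finally have N0: "poly N (x 0) = (x 0 - z0)\<^sup>2 * (\<Prod>j\<in>{..<n} - {0}. x 0 - x j)"
    by (simp add: poly_prod a_def)
  have "ennreal (pi * cmod (poly N (x 0))) \<le> (\<integral>\<^sup>+z. ennreal (cmod (poly N z)) * indicator U z \<partial>lborel)"
    unfolding U_def by (rule nn_integral_annulus_poly_ge)
  also have "\<dots> \<le> (\<integral>\<^sup>+z. ennreal (8 ^ (n + 2)) * (ennreal (cmod (\<psi> z)) * indicator U z) \<partial>lborel)"
  proof (intro nn_integral_mono)
    fix z
    have "cmod (poly N z) \<le> 8 ^ (n + 2) * cmod (\<psi> z)" if z: "z \<in> U"
    proof -
      have "z \<noteq> z0" "z \<noteq> x i" for i
        using U_far[OF z] z0 x_upper[of i] by auto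
      then have "cmod (poly N z) = (cmod (z - z0))\<^sup>2 * (\<Prod>j<n. cmod (z - x j)) * cmod (\<psi> z)"
        by (subst N) (auto simp: norm_mult norm_power prod_norm)
      also have "\<dots> \<le> 8\<^sup>2 * (\<Prod>j<n. 8) * cmod (\<psi> z)"
        using U_far[OF z] by (intro mult_right_mono mult_mono power_mono prod_mono prod_nonneg) auto
      finally show ?thesis by (simp add: power_add mult_ac)
    qed
    then show "ennreal (cmod (poly N z)) * indicator U z \<le> ennreal (8 ^ (n + 2)) * (ennreal (cmod (\<psi> z)) * indicator U z)"
      by (auto simp: ennreal_mult[symmetric] intro!: ennreal_leI split: split_indicator)
  qed
  also have "\<dots> = ennreal (8 ^ (n + 2)) * (\<integral>\<^sup>+z. ennreal (cmod (\<psi> z)) * indicator U z \<partial>lborel)"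
    by (rule nn_integral_cmult) (use \<psi>_meas in measurable)
  also have "\<dots> \<le> ennreal (8 ^ (n + 2)) * ennreal (cmod \<epsilon> * (40 * pi))"
    by (intro mult_left_mono \<psi>_U) simp
  also have "\<dots> = ennreal (8 ^ (n + 2) * (cmod \<epsilon> * (40 * pi)))"
    by (rule ennreal_mult[symmetric]) auto
  finally have "pi * cmod (poly N (x 0)) \<le> 8 ^ (n + 2) * (cmod \<epsilon> * (40 * pi))"
    by (subst (asm) ennreal_le_iff) auto
  then have "cmod (poly N (x 0)) \<le> 40 * 8 ^ (n + 2) * cmod \<epsilon>"
    using pi_gt_zero by (simp add: algebra_simps)
  then show ?thesis
    unfolding N0 \<epsilon>_def a_def by (simp add: norm_mult norm_power prod_norm)
qed

section \<open>Small cycles near a fixed point\<close>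

text \<open>Each step multiplies the distance to \<open>z0\<close> by
  \<open>|2 * z0 + (x i - z0)|\<close>, which \<open>near\<close> keeps on the same side of 1 as
  \<open>|2 * z0|\<close>. The distance is then strictly monotone and cannot return to its initial
  value.\<close>

lemma hyperbolic_no_small_cycle:
  fixes z0 c p :: complex
  defines "f \<equiv> (\<lambda>z. z\<^sup>2 + c)"
  assumes fixed: "z0\<^sup>2 + c = z0" and n: "n > 1" and p: "has_minimal_period f n p"
    and near: "\<And>s. s \<in> periodic_orbit f n p \<Longrightarrow> cmod (s - z0) < \<bar>cmod (2 * z0) - 1\<bar>"
  shows False
proof -
  define x where "x = (\<lambda>i. (f ^^ i) p)"
  define d where "d = (\<lambda>i. cmod (x i - z0))"
  have x: "x i \<in> periodic_orbit f n p" for i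
    unfolding x_def by (rule funpow_in_periodic_orbit[OF p])
  have "z0 \<notin> periodic_orbit f n p"
    using fixed by (intro fixed_notin_periodic_orbit[OF p n]) (simp add: f_def)
  then have d_pos: "d i > 0" for i using x[of i] by (auto simp: d_def)
  have d_Suc: "d (Suc i) = d i * cmod (2 * z0 + (x i - z0))" for i
  proof -
    have "x (Suc i) - z0 = (x i - z0) * (2 * z0 + (x i - z0))"
      using fixed by (simp add: x_def f_def algebra_simps power2_eq_square)
    then show ?thesis by (simp only: d_def norm_mult)
  qed
  have "d n = d 0" using p by (simp add: d_def x_def has_minimal_period_def)
  show False
  proof (cases "cmod (2 * z0) > 1")
    case True
    have inc: "d i < d (Suc i)" for i
    proof -
      have "1 < cmod (2 * z0 + (x i - z0))"
        using near[OF x[of i]] True norm_diff_ineq[of "2 * z0" "x i - z0"] by linarith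
      then show ?thesis using d_pos[of i] by (simp add: d_Suc)
    qed
    have "d 0 < d n"
      by (rule lift_Suc_mono_less[of d, OF inc]) (use n in simp)
    then show False using \<open>d n = d 0\<close> by simp
  next
    case False
    \<comment> \<open>The sign change allows the same monotonicity lemma to be used in the
      attracting case.\<close>
    have dec: "- d i < - d (Suc i)" for i
    proof -
      have "cmod (2 * z0 + (x i - z0)) < 1"
      proof -
        have "\<bar>cmod (2 * z0) - 1\<bar> = 1 - cmod (2 * z0)" using False by linarith
        then have "cmod (2 * z0) + cmod (x i - z0) < 1"
          using near[OF x[of i]] by linarith
        then show ?thesis by (rule le_less_trans[OF norm_triangle_ineq])
      qed
      then show ?thesis using d_pos[of i] by (simp add: d_Suc)
    qed
    have "- d 0 < - d n"
      by (rule lift_Suc_mono_less[of "\<lambda>i. - d i", OF dec]) (use n in simp)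
    then show False using \<open>d n = d 0\<close> by simp
  qed
qed

text \<open>In the coordinate \<open>u = z - z0\<close> the map is \<open>u + u\<^sup>2\<close>, so
  around a cycle the squares \<open>(u i)\<^sup>2\<close> sum to 0. On a small cycle each square
  differs from \<open>(u 0)\<^sup>2\<close> by at most three quarters of its size, so no such
  cancellation is possible.\<close>

lemma cusp_no_small_cycle:
  fixes z0 c p :: complex
  defines "f \<equiv> (\<lambda>z. z\<^sup>2 + c)"
  assumes fixed: "z0\<^sup>2 + c = z0" and cusp: "2 * z0 = 1"
    and n: "n > 1" and p: "has_minimal_period f n p"
    and near: "\<And>s. s \<in> periodic_orbit f n p \<Longrightarrow> cmod (s - z0) \<le> 1 / (8 * real n)"
  shows False
proof -
  define u where "u = (\<lambda>i. (f ^^ i) p - z0)"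
  have x: "(f ^^ i) p \<in> periodic_orbit f n p" for i
    by (rule funpow_in_periodic_orbit[OF p])
  have u_le: "cmod (u i) \<le> 1 / (8 * real n)" for i
    unfolding u_def by (rule near[OF x])
  have "z0 \<notin> periodic_orbit f n p"
    using fixed by (intro fixed_notin_periodic_orbit[OF p n]) (simp add: f_def)
  then have u0: "u 0 \<noteq> 0" using x[of 0] by (auto simp: u_def)
  have "z0 = 2 * z0 / 2" by simp
  then have z0: "z0 = 1 / 2" unfolding cusp .
  have "c = z0 - z0\<^sup>2" using fixed by (simp add: eq_diff_eq add.commute)
  then have c: "c = 1 / 4" by (simp add: z0 power2_eq_square)
  have u_Suc: "u (Suc i) - u i = (u i)\<^sup>2" for i
    by (simp add: u_def f_def z0 c algebra_simps power2_eq_square)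
  have u_2: "cmod (u i) \<le> 2 * cmod (u 0)" if "i \<le> n" for i
  proof -
    have "cmod (p - z0) \<le> 1 / (4 * real n)"
      using u_le[of 0] n by (simp add: u_def field_simps)
    then show ?thesis
      using neutral_iterate_bound[OF fixed _ _ _ that, of p] cusp n by (simp add: u_def f_def)
  qed
  \<comment> \<open>Fewer than \<open>n\<close> increments, each at most
    \<open>1 / (8 * real n)\<close> times \<open>2 * cmod (u 0)\<close>.\<close>
  have drift: "cmod (u i - u 0) \<le> cmod (u 0) / 4" if "i < n" for i
  proof -
    have "cmod (u i - u 0) = cmod (\<Sum>j<i. (u j)\<^sup>2)"
      using sum_lessThan_telescope[of u i] by (simp add: u_Suc)
    also have "\<dots> \<le> (\<Sum>j<i. cmod (u j) * cmod (u j))"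
      by (rule order_trans[OF norm_sum]) (simp add: power2_eq_square norm_mult)
    also have "\<dots> \<le> (\<Sum>j<i. 1 / (8 * real n) * (2 * cmod (u 0)))"
      using that by (intro sum_mono mult_mono u_le u_2) auto
    also have "\<dots> = real i * (1 / (8 * real n) * (2 * cmod (u 0)))" by simp
    also have "\<dots> \<le> real n * (1 / (8 * real n) * (2 * cmod (u 0)))"
      using that by (intro mult_right_mono) auto
    also have "\<dots> = cmod (u 0) / 4" using n by simp
    finally show ?thesis .
  qed
  have "(\<Sum>i<n. (u i)\<^sup>2) = u n - u 0"
    using sum_lessThan_telescope[of u n] by (simp add: u_Suc)
  also have "\<dots> = 0" using p by (simp add: u_def has_minimal_period_def)
  finally have "real n * (cmod (u 0))\<^sup>2 = cmod (\<Sum>i<n. (u 0)\<^sup>2 - (u i)\<^sup>2)"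
    by (simp add: sum_subtractf norm_mult norm_power)
  also have "\<dots> \<le> (\<Sum>i<n. 3 / 4 * (cmod (u 0))\<^sup>2)"
  proof (rule sum_norm_le)
    fix i assume "i \<in> {..<n}"
    then have i: "i < n" by simp
    have "(u 0)\<^sup>2 - (u i)\<^sup>2 = - ((u i - u 0) * (u i + u 0))"
      by (simp add: algebra_simps power2_eq_square)
    then have "cmod ((u 0)\<^sup>2 - (u i)\<^sup>2) = cmod (u i - u 0) * cmod (u i + u 0)"
      by (simp only: norm_minus_cancel norm_mult)
    also have "\<dots> \<le> cmod (u 0) / 4 * (3 * cmod (u 0))"
      using drift[OF i] u_2[of i] i norm_triangle_ineq[of "u i" "u 0"] by (intro mult_mono) auto
    finally show "cmod ((u 0)\<^sup>2 - (u i)\<^sup>2) \<le> 3 / 4 * (cmod (u 0))\<^sup>2"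
      by (simp add: power2_eq_square)
  qed
  finally show False using u0 n by simp
qed

text \<open>The product \<open>D\<close> of distances within the cycle of \<open>p\<close> occurs in
  the lower and in the upper estimate and cancels. The second cycle contributes \<open>n\<close>
  further factors of size at most \<open>2 * a\<close> to the upper one; against the two powers of
  \<open>a\<close> on the left this leaves \<open>a ^ (n - 1)\<close>.\<close>

lemma neutral_two_cycles_bound:
  fixes z0 c p q :: complex
  defines "f \<equiv> (\<lambda>z. z\<^sup>2 + c)"
  assumes fixed: "z0\<^sup>2 + c = z0" and neutral: "cmod (2 * z0) = 1" and not_one: "2 * z0 \<noteq> 1"
    and n: "n > 1" and p: "has_minimal_period f n p" and q: "has_minimal_period f n q"
    and neq: "periodic_orbit f n p \<noteq> periodic_orbit f n q"
    and near: "cmod (p - z0) \<le> 1 / (8 * real n)"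
    and max: "\<And>s. s \<in> periodic_orbit f n p \<union> periodic_orbit f n q \<Longrightarrow> cmod (s - z0) \<le> cmod (p - z0)"
  shows "1 \<le> 7864320 * (8 * real n) ^ 4 * cmod (p - z0)"
proof -
  define x where "x = (\<lambda>i. (f ^^ i) p)"
  define a where "a = cmod (p - z0)"
  define Op where "Op = periodic_orbit f n p"
  define Oq where "Oq = periodic_orbit f n q"
  define D where "D = (\<Prod>j\<in>{..<n} - {0}. cmod (x 0 - x j))"
  define \<rho> where "\<rho> = (\<Prod>j<n. 2 * x j)"
  have Op: "Op = x ` {..<n}"
    unfolding Op_def periodic_orbit_eq_image x_def by simp
  have inj: "inj_on x {..<n}"
    unfolding x_def by (rule minimal_period_inj_on[OF p])
  have x_in: "x i \<in> Op" for i
    unfolding x_def Op_def by (rule funpow_in_periodic_orbit[OF p])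
  have x_Suc: "x (Suc i) = (x i)\<^sup>2 + c" for i by (simp add: x_def f_def)
  have x_n: "x n = x 0" using p by (simp add: x_def has_minimal_period_def)
  have x0: "x 0 = p" by (simp add: x_def)
  have fin: "finite Op" "finite Oq"
    by (simp_all add: Op_def Oq_def finite_periodic_orbit)
  have z0_notin: "z0 \<notin> Op" "z0 \<notin> Oq"
    using fixed n p q unfolding Op_def Oq_def by (auto simp: f_def dest!: fixed_notin_periodic_orbit[of _ _ _ z0])
  have disj: "Op \<inter> Oq = {}"
    unfolding Op_def Oq_def by (rule periodic_orbits_disjoint[OF p q neq])
  have a: "a > 0" using z0_notin x_in[of 0] by (auto simp: a_def x0)
  have a_le: "a \<le> 1 / (8 * real n)" using near by (simp add: a_def)
  have max': "cmod (s - z0) \<le> a" if "s \<in> Op \<union> Oq" for s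
    using max that by (simp add: a_def Op_def Oq_def)
  have a_4: "a \<le> 1 / 4"
  proof -
    have "1 / (8 * real n) \<le> 1 / 4" using n by (simp add: field_simps)
    then show ?thesis using a_le by simp
  qed
  have D: "D > 0"
    unfolding D_def
  proof (rule prod_pos)
    fix j assume "j \<in> {..<n} - {0}"
    then have "x 0 \<noteq> x j" using inj n by (auto simp: inj_on_def)
    then show "0 < cmod (x 0 - x j)" by simp
  qed

  have sep: "a\<^sup>2 * D \<le> 40 * 8 ^ (n + 2) * cmod (1 / \<rho> - 1)"
  proof -
    have "cmod (x i - z0) \<le> 1 / 4" for i using max'[of "x i"] x_in a_4 by fastforce
    moreover have "x i \<noteq> z0" for i using x_in z0_notin by metis
    ultimately have "(cmod (x 0 - z0))\<^sup>2 * D \<le> 40 * 8 ^ (n + 2) * cmod ((\<Prod>j<n. 1 / (2 * x j)) - 1)"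
      unfolding D_def using n
      by (intro cycle_separation_bound[OF fixed neutral not_one _ x_Suc x_n inj]) auto
    then show ?thesis
      by (simp only: prod_dividef prod.neutral_const x0 a_def \<rho>_def)
  qed

  have mult: "cmod (\<rho> - 1) \<le> a * D * (2 * a) ^ n * (6 * (8 * real n) ^ (2 * n))"
  proof -
    define S where "S = insert z0 (Op \<union> Oq)"
    have "(f ^^ n) z0 = z0"
      using fixed by (induction n) (simp_all add: f_def)
    moreover have "(f ^^ n) s = s" if "s \<in> Op \<union> Oq" for s
      using that periodic_orbit_shift(1)[OF p] periodic_orbit_shift(1)[OF q]
      by (auto simp: Op_def Oq_def has_minimal_period_def)
    ultimately have "cmod ((\<Prod>i<n. 2 * (f ^^ i) p) - 1)
        \<le> (\<Prod>s\<in>S - {p}. cmod (p - s)) * (3 / (4 * real n) * (8 * real n) ^ card S)"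
      unfolding f_def
      by (intro multiplier_minus_one_bound[OF fixed neutral])
        (use n fin x_in[of 0] max' a_le in \<open>auto simp: S_def x0 intro: order_trans\<close>)
    also have "card S = 2 * n + 1"
      using fin z0_notin disj card_periodic_orbit[OF p] card_periodic_orbit[OF q]
      by (simp add: S_def card_Un_disjoint Op_def Oq_def)
    also have "3 / (4 * real n) * (8 * real n) ^ (2 * n + 1) = 6 * (8 * real n) ^ (2 * n)"
      using n by simp
    also have "(\<Prod>s\<in>S - {p}. cmod (p - s)) = a * D * (\<Prod>s\<in>Oq. cmod (p - s))"
    proof -
      have "S - {p} = insert z0 ((Op - {p}) \<union> Oq)"
        using disj x_in[of 0] z0_notin by (auto simp: S_def x0)
      moreover have "(\<Prod>s\<in>Op - {p}. cmod (p - s)) = D"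
      proof -
        have "Op - {p} = x ` ({..<n} - {0})"
          unfolding Op using inj n by (subst inj_on_image_set_diff[OF inj]) (auto simp: x0)
        moreover have "inj_on x ({..<n} - {0})" using inj by (rule inj_on_subset) auto
        ultimately show ?thesis unfolding D_def by (simp add: prod.reindex x0)
      qed
      moreover have "(\<Prod>s\<in>(Op - {p}) \<union> Oq. cmod (p - s)) = (\<Prod>s\<in>Op - {p}. cmod (p - s)) * (\<Prod>s\<in>Oq. cmod (p - s))"
        using fin disj by (intro prod.union_disjoint) auto
      moreover have "(\<Prod>s\<in>insert z0 ((Op - {p}) \<union> Oq). cmod (p - s)) = cmod (p - z0) * (\<Prod>s\<in>(Op - {p}) \<union> Oq. cmod (p - s))"
        using fin z0_notin by (intro prod.insert) auto
      ultimately show ?thesis by (simp only: a_def mult.assoc)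
    qed
    \<comment> \<open>Since \<open>p\<close> is the farthest point, the second cycle also lies
      within \<open>a\<close> of \<open>z0\<close>, so each of its points is within
      \<open>2 * a\<close> of \<open>p\<close>.\<close>
    also have "a * D * (\<Prod>s\<in>Oq. cmod (p - s)) * (6 * (8 * real n) ^ (2 * n))
        \<le> a * D * (\<Prod>s\<in>Oq. 2 * a) * (6 * (8 * real n) ^ (2 * n))"
    proof -
      have "cmod (p - s) \<le> 2 * a" if "s \<in> Oq" for s
      proof -
        have "p - s = (p - z0) - (s - z0)" by simp
        then have "cmod (p - s) \<le> cmod (p - z0) + cmod (s - z0)"
          using norm_triangle_ineq4[of "p - z0" "s - z0"] by (simp only:)
        moreover have "cmod (s - z0) \<le> a" using that by (intro max') simp
        ultimately show ?thesis by (simp add: a_def)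
      qed
      then have "(\<Prod>s\<in>Oq. cmod (p - s)) \<le> (\<Prod>s\<in>Oq. 2 * a)"
        by (intro prod_mono) simp
      moreover have "0 \<le> a * D" using a D by simp
      moreover have "0 \<le> 6 * (8 * real n) ^ (2 * n)" by simp
      ultimately show ?thesis by (intro mult_right_mono mult_left_mono)
    qed
    also have "(\<Prod>s\<in>Oq. 2 * a) = (2 * a) ^ n"
      using card_periodic_orbit[OF q] by (simp add: Oq_def)
    finally show ?thesis unfolding \<rho>_def x_def .
  qed

  \<comment> \<open>Each factor has modulus at least \<open>1 - 1 / (4 * real n)\<close>; by
    Bernoulli the product of \<open>n\<close> of them is at least 3/4. This permits exchanging
    \<open>1 / \<rho> - 1\<close> for \<open>\<rho> - 1\<close>.\<close>
  have \<rho>: "cmod \<rho> \<ge> 1 / 2"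
  proof -
    have "(1::real) / 2 \<le> 1 + real n * (- (1 / (4 * real n)))" using n by simp
    also have "\<dots> \<le> (1 + - (1 / (4 * real n))) ^ n"
      using n by (intro Bernoulli_inequality) (simp add: field_simps)
    also have "\<dots> = (\<Prod>j<n. 1 - 1 / (4 * real n))" by simp
    also have "\<dots> \<le> (\<Prod>j<n. cmod (2 * x j))"
    proof (intro prod_mono conjI)
      fix j
      have "cmod (x j - z0) \<le> 1 / (8 * real n)" using max'[of "x j"] x_in a_le by fastforce
      moreover have "cmod (2 * z0) \<le> cmod (2 * x j) + cmod (2 * (x j - z0))"
        using norm_triangle_ineq4[of "2 * x j" "2 * (x j - z0)"] by (simp add: algebra_simps)
      moreover have "cmod (2 * (x j - z0)) = 2 * cmod (x j - z0)"
        unfolding norm_mult by simp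
      moreover have "1 / (4 * real n) = 2 * (1 / (8 * real n))" by simp
      ultimately show "1 - 1 / (4 * real n) \<le> cmod (2 * x j)" using neutral by linarith
      show "0 \<le> 1 - 1 / (4 * real n)" using n by (simp add: field_simps)
    qed
    also have "\<dots> = cmod \<rho>" unfolding \<rho>_def by (rule prod_norm)
    finally show ?thesis .
  qed
  have "cmod (1 / \<rho> - 1) \<le> 2 * cmod (\<rho> - 1)"
  proof -
    have "1 / \<rho> - 1 = (1 - \<rho>) / \<rho>" using \<rho> by (auto simp: diff_divide_distrib)
    then have "cmod (1 / \<rho> - 1) = cmod (\<rho> - 1) / cmod \<rho>"
      by (simp add: norm_divide norm_minus_commute)
    also have "\<dots> \<le> cmod (\<rho> - 1) / (1 / 2)"
      using \<rho> by (intro divide_left_mono) auto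
    finally show ?thesis by simp
  qed
  then have "a\<^sup>2 * D \<le> 40 * 8 ^ (n + 2) * (2 * (a * D * (2 * a) ^ n * (6 * (8 * real n) ^ (2 * n))))"
    using mult by (intro order_trans[OF sep] mult_left_mono) auto
  \<comment> \<open>Here \<open>30720 = 40 * 8^2 * 2 * 6\<close>, and \<open>16 ^ n\<close> collects
    \<open>8 ^ n\<close> and \<open>2 ^ n\<close>.\<close>
  also have "\<dots> = a * D * (a * (30720 * 16 ^ n * (8 * real n) ^ (2 * n) * a ^ (n - 1)))"
  proof -
    have "a ^ n = a * a ^ (n - 1)" using n by (cases n) auto
    moreover have "(16::real) ^ n = 8 ^ n * 2 ^ n" by (simp flip: power_mult_distrib)
    ultimately show ?thesis by (simp add: power_add power_mult_distrib)
  qed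
  finally have "(a * (a * D)) * 1 \<le> (a * (a * D)) * (30720 * 16 ^ n * (8 * real n) ^ (2 * n) * a ^ (n - 1))"
    by (simp add: power2_eq_square mult_ac)
  then have "1 \<le> 30720 * 16 ^ n * (8 * real n) ^ (2 * n) * a ^ (n - 1)"
    using a D by (subst (asm) mult_le_cancel_left_pos) auto
  \<comment> \<open>For \<open>n > 1\<close> the inequality \<open>n \<le> 2 * (n - 1)\<close> turns
    the whole right-hand side into an \<open>(n - 1)\<close>-th power, whose root can then be
    taken.\<close>
  also have "\<dots> \<le> 30720 ^ (n - 1) * 16 ^ (2 * (n - 1)) * (8 * real n) ^ (4 * (n - 1)) * a ^ (n - 1)"
  proof -
    have "(30720::real) \<le> 30720 ^ (n - 1)" using n by (intro self_le_power) auto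
    moreover have "(16::real) ^ n \<le> 16 ^ (2 * (n - 1))" using n by (intro power_increasing) auto
    moreover have "(8 * real n) ^ (2 * n) \<le> (8 * real n) ^ (4 * (n - 1))"
      using n by (intro power_increasing) auto
    ultimately show ?thesis
      using a by (intro mult_right_mono[OF mult_mono[OF mult_mono]]) simp_all
  qed
  also have "\<dots> = (7864320 * (8 * real n) ^ 4 * a) ^ (n - 1)"
  proof -
    have "(7864320::real) = 30720 * 16\<^sup>2" by simp
    then show ?thesis by (simp only: power_mult power_mult_distrib)
  qed
  finally have *: "1 \<le> (7864320 * (8 * real n) ^ 4 * a) ^ (n - 1)" .
  show ?thesis
  proof (rule ccontr)
    assume "\<not> ?thesis"
    then have "7864320 * (8 * real n) ^ 4 * a < 1" by (simp add: a_def)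
    then have "(7864320 * (8 * real n) ^ 4 * a) ^ (n - 1) < 1 ^ (n - 1)"
      using a n by (intro power_strict_mono) auto
    then show False using * by simp
  qed
qed

theorem theorem2:
  fixes c z0 :: complex and \<delta> :: real
  defines "f \<equiv> (\<lambda>z. z\<^sup>2 + c)"
  assumes fixed: "f z0 = z0"
    and delta_pos: "\<delta> > 0"
  shows "\<exists>r0 > 0. \<forall>n :: nat. n > 1 \<longrightarrow>
           (\<forall>p q. has_minimal_period f n p \<and> has_minimal_period f n q
                 \<and> periodic_orbit f n p \<subseteq> ball z0 (r0 * exp (- real n * \<delta>))
                 \<and> periodic_orbit f n q \<subseteq> ball z0 (r0 * exp (- real n * \<delta>))
                 \<longrightarrow> periodic_orbit f n p = periodic_orbit f n q)"
proof -
  have fix_eq: "z0\<^sup>2 + c = z0" using fixed by (simp add: f_def)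
  show ?thesis
  proof (cases "cmod (2 * z0) = 1")
    case False
    show ?thesis
    \<comment> \<open>Since \<open>exp (- real n * \<delta>) \<le> 1\<close>, this radius already
      excludes every cycle of period \<open>n > 1\<close>, and the claim holds vacuously.\<close>
    proof (intro exI[of _ "\<bar>cmod (2 * z0) - 1\<bar>"] conjI allI impI)
      show "0 < \<bar>cmod (2 * z0) - 1\<bar>" using False by simp
      fix n :: nat and p q
      assume n: "1 < n" and pq: "has_minimal_period f n p \<and> has_minimal_period f n q
        \<and> periodic_orbit f n p \<subseteq> ball z0 (\<bar>cmod (2 * z0) - 1\<bar> * exp (- real n * \<delta>))
        \<and> periodic_orbit f n q \<subseteq> ball z0 (\<bar>cmod (2 * z0) - 1\<bar> * exp (- real n * \<delta>))"
      have "\<bar>cmod (2 * z0) - 1\<bar> * exp (- real n * \<delta>) \<le> \<bar>cmod (2 * z0) - 1\<bar>"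
        using delta_pos by (intro mult_left_le) auto
      then have "cmod (s - z0) < \<bar>cmod (2 * z0) - 1\<bar>" if "s \<in> periodic_orbit f n p" for s
        using pq that by (fastforce simp: dist_norm norm_minus_commute)
      then have False
        using hyperbolic_no_small_cycle[OF fix_eq n, of p] pq unfolding f_def by blast
      then show "periodic_orbit f n p = periodic_orbit f n q" ..
    qed
  next
    case neutral: True
    define K :: real where "K = 7864320 * 8 ^ 4"
    \<comment> \<open>With \<open>x = real n * \<delta>\<close>, the bound
      \<open>(1 + x / 4) ^ 4 \<le> exp x\<close> gives \<open>x ^ 4 / 256 \<le> exp x\<close>; with
      this \<open>r0\<close> the exponential absorbs the factor \<open>real n ^ 4\<close> whatever
      \<open>\<delta>\<close> is.\<close>
    define r0 where "r0 = \<delta> ^ 4 / (256 * K)"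
    have K: "K \<ge> 1" by (simp add: K_def)
    have r0: "r0 > 0" using delta_pos K by (simp add: r0_def)
    have small: "K * real n ^ 4 * (r0 * exp (- real n * \<delta>)) \<le> 1" for n
    proof -
      have "(real n * \<delta>) ^ 4 / 256 = (real n * \<delta> / 4) ^ 4"
        by (simp add: power_divide)
      also have "\<dots> \<le> (1 + real n * \<delta> / 4) ^ 4"
        using delta_pos by (intro power_mono) auto
      also have "\<dots> \<le> exp (real n * \<delta>)"
        using exp_ge_one_plus_x_over_n_power_n[of 4 "real n * \<delta>"] delta_pos
        by (simp add: order_trans[of _ 0])
      finally have "(real n * \<delta>) ^ 4 / 256 \<le> exp (real n * \<delta>)" .
      then have "(real n * \<delta>) ^ 4 / 256 * exp (- (real n * \<delta>)) \<le> exp (real n * \<delta>) * exp (- (real n * \<delta>))"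
        by (rule mult_right_mono) simp
      moreover have "K * real n ^ 4 * (r0 * exp (- real n * \<delta>)) = (real n * \<delta>) ^ 4 / 256 * exp (- (real n * \<delta>))"
        using K by (simp add: r0_def power_mult_distrib)
      moreover have "exp (real n * \<delta>) * exp (- (real n * \<delta>)) = 1"
        by (simp flip: exp_add)
      ultimately show ?thesis by linarith
    qed
    show ?thesis
    proof (intro exI[of _ r0] conjI allI impI)
      show "0 < r0" by (rule r0)
      fix n :: nat and p q
      define r where "r = r0 * exp (- real n * \<delta>)"
      assume n: "1 < n" and "has_minimal_period f n p \<and> has_minimal_period f n q
        \<and> periodic_orbit f n p \<subseteq> ball z0 (r0 * exp (- real n * \<delta>))
        \<and> periodic_orbit f n q \<subseteq> ball z0 (r0 * exp (- real n * \<delta>))"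
      then have p: "has_minimal_period f n p" and q: "has_minimal_period f n q"
        and near: "\<And>s. s \<in> periodic_orbit f n p \<union> periodic_orbit f n q \<Longrightarrow> cmod (s - z0) < r"
        by (auto simp: r_def dist_norm norm_minus_commute)
      have r: "K * real n ^ 4 * r \<le> 1" "0 < r" using small r0 by (simp_all add: r_def)
      have r8: "r \<le> 1 / (8 * real n)"
      proof -
        have "8 * real n \<le> K * real n ^ 4"
          using n self_le_power[of "real n" 4] by (intro mult_mono) (auto simp: K_def)
        then have "8 * real n * r \<le> K * real n ^ 4 * r"
          using r(2) by (intro mult_right_mono) auto
        then show ?thesis using r(1) n by (simp add: field_simps)
      qed
      show "periodic_orbit f n p = periodic_orbit f n q"
      proof (cases "2 * z0 = 1")
        case True
        have "cmod (s - z0) \<le> 1 / (8 * real n)" if "s \<in> periodic_orbit f n p" for s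
          using near[of s] that r8 by simp
        then have False
          using cusp_no_small_cycle[OF fix_eq True n, of p] p unfolding f_def by blast
        then show ?thesis ..
      next
        case False
        \<comment> \<open>Stated for arbitrary \<open>P\<close> and \<open>Q\<close> because the
          point farthest from \<open>z0\<close> may lie on either of the two cycles.\<close>
        have no: False
          if P: "has_minimal_period f n P" and Q: "has_minimal_period f n Q"
            and neq: "periodic_orbit f n P \<noteq> periodic_orbit f n Q" and P_near: "cmod (P - z0) < r"
            and "\<And>s. s \<in> periodic_orbit f n P \<union> periodic_orbit f n Q \<Longrightarrow> cmod (s - z0) \<le> cmod (P - z0)"
          for P Q
        proof -
          have "1 \<le> 7864320 * (8 * real n) ^ 4 * cmod (P - z0)"
            using neutral_two_cycles_bound[OF fix_eq neutral False n, of P Q] that r8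
            unfolding f_def by simp
          also have "\<dots> = K * real n ^ 4 * cmod (P - z0)"
            by (simp add: K_def power_mult_distrib)
          also have "\<dots> < K * real n ^ 4 * r"
            using P_near n K by (intro mult_strict_left_mono) auto
          finally show False using r(1) by simp
        qed
        define O2 where "O2 = periodic_orbit f n p \<union> periodic_orbit f n q"
        have "finite O2" "O2 \<noteq> {}"
          using n start_in_periodic_orbit[of n p f] by (auto simp: O2_def finite_periodic_orbit)
        then have m: "Max ((\<lambda>s. cmod (s - z0)) ` O2) \<in> (\<lambda>s. cmod (s - z0)) ` O2"
          by (intro Max_in) auto
        then obtain P where "P \<in> O2" "Max ((\<lambda>s. cmod (s - z0)) ` O2) = cmod (P - z0)"
          by blast
        with \<open>finite O2\<close> have P: "P \<in> O2" "\<And>s. s \<in> O2 \<Longrightarrow> cmod (s - z0) \<le> cmod (P - z0)"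
          using Max_ge[of "(\<lambda>s. cmod (s - z0)) ` O2"] by auto
        show ?thesis
        proof (rule ccontr)
          assume neq: "periodic_orbit f n p \<noteq> periodic_orbit f n q"
          consider "P \<in> periodic_orbit f n p" | "P \<in> periodic_orbit f n q"
            using P(1) by (auto simp: O2_def)
          then show False
          proof cases
            case 1
            note sh = periodic_orbit_shift[OF p 1]
            show False
              using no[OF sh(1) q] sh(2) neq P near unfolding O2_def by auto
          next
            case 2
            note sh = periodic_orbit_shift[OF q 2]
            show False
              using no[OF sh(1) p] sh(2) neq P near unfolding O2_def by auto
          qed
        qed
      qed
    qed
  qed
qed

end
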